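(* Let $S$ be an $\mathbb{N}$-graded Cohen-Macaulay normal domain, such that the degree zero component is a field $K$ of positive characteristic, and $S$ is a finitely generated $K$-algebra. Let $\mathfrak{n}$ denote the homogeneous maximal ideal of $S$, and set $d:=\dim S$. Suppose each nonzero element of $\mathfrak{n}$ has a power that is a test element, and that there exists an integer $n>0$ such that the Frobenius action on $[H^d_{\mathfrak{n}}(S)]_{\leq -n}$ is injective. Then the tight closure of zero in $H^d_{\mathfrak{n}}(S)$ is contained in $[H^d_{\mathfrak{n}}(S)]_{>-n}$.
   Context: Let $p>0$ be the characteristic of $K$. The local cohomology module $H^d_{\mathfrak{n}}(S)$ carries its natural $\mathbb{Z}$-grading: computing it by the Čech complex on a homogeneous system of parameters $x_1,\dots,x_d$, the class $\left[\frac{r}{x_1^k\cdots x_d^k}\right]$ with $r\in S$ homogeneous has degree $\deg r-k\sum_i\deg x_i$. For an integer $j$, $[H^d_{\mathfrak{n}}(S)]_{\leq j}$ and $[H^d_{\mathfrak{n}}(S)]_{>j}$ denote the direct sums of the graded components of degree $\leq j$, respectively $>j$. The Frobenius action $F\colon H^d_{\mathfrak{n}}(S)\to H^d_{\mathfrak{n}}(S)$ is the additive map induced by the Frobenius endomorphism of $S$, namely $\left[\frac{r}{x_1^k\cdots x_d^k}\right]\mapsto\left[\frac{r^p}{x_1^{kp}\cdots x_d^{kp}}\right]$; it multiplies degrees by $p$. Its injectivity on $[H^d_{\mathfrak{n}}(S)]_{\leq -n}$ means that its restriction to this subgroup is injective. The tight closure of zero in $H^d_{\mathfrak{n}}(S)$,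 denoted $0^*_{H^d_{\mathfrak{n}}(S)}$, is the set of $\eta\in H^d_{\mathfrak{n}}(S)$ for which there exists a nonzero $c\in S$ with $cF^e(\eta)=0$ for all $e\in\mathbb{N}$. For an ideal $I$ of $S$, the tight closure $I^*$ is the set of $z\in S$ for which there is a nonzero $c\in S$ with $cz^{p^e}\in I^{[p^e]}$ for all $e\gg 0$, where $I^{[p^e]}$ is generated by the $p^e$-th powers of elements of $I$. A nonzero element $c\in S$ is a test element if for every ideal $I$ of $S$ and every $z\in I^*$ one has $cz^{p^e}\in I^{[p^e]}$ for all $e\geq 0$. *)

theory Defs
  imports
    "HOL-Computational_Algebra.Computational_Algebra"
    "HOL-Library.Extended_Nat"
    "HOL-Library.Set_Algebras"
begin

section \<open>Ideals, dimension, depth\<close>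

text \<open>The ring is the whole type \<open>'a\<close>. Its ideals are the submodules of the regular module.\<close>

abbreviation ideal :: "'a::comm_ring_1 set \<Rightarrow> bool" where
  "ideal \<equiv> module.subspace (*)"

abbreviation ideal_gen :: "'a::comm_ring_1 set \<Rightarrow> 'a set" where
  "ideal_gen \<equiv> module.span (*)"

definition prime_ideal :: "'a::comm_ring_1 set \<Rightarrow> bool" where
  "prime_ideal P \<longleftrightarrow> ideal P \<and> P \<noteq> UNIV \<and> (\<forall>a b. a * b \<in> P \<longrightarrow> a \<in> P \<or> b \<in> P)"

definition maximal_ideal :: "'a::comm_ring_1 set \<Rightarrow> bool" where
  "maximal_ideal M \<longleftrightarrow> ideal M \<and> M \<noteq> UNIV \<and> (\<forall>I. ideal I \<and> M \<subseteq> I \<longrightarrow> I = M \<or> I = UNIV)"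

definition noetherian :: "'a::comm_ring_1 itself \<Rightarrow> bool" where
  "noetherian _ \<longleftrightarrow> (\<forall>I :: 'a set. ideal I \<longrightarrow> (\<exists>G. finite G \<and> I = ideal_gen G))"

definition prime_chain :: "nat \<Rightarrow> (nat \<Rightarrow> 'a::comm_ring_1 set) \<Rightarrow> bool" where
  "prime_chain l Q \<longleftrightarrow> (\<forall>i\<le>l. prime_ideal (Q i)) \<and> (\<forall>i<l. Q i \<subset> Q (Suc i))"

definition krull_dim :: "'a::comm_ring_1 itself \<Rightarrow> enat" where
  "krull_dim _ = Sup {enat l | l. \<exists>Q :: nat \<Rightarrow> 'a set. prime_chain l Q}"

definition height :: "'a::comm_ring_1 set \<Rightarrow> enat" where
  "height P = Sup {enat l | l. \<exists>Q. prime_chain l Q \<and> Q l = P}"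

definition regular_sequence :: "'a::comm_ring_1 list \<Rightarrow> bool" where
  "regular_sequence xs \<longleftrightarrow>
     (\<forall>i<length xs. \<forall>s. xs ! i * s \<in> ideal_gen (set (take i xs)) \<longrightarrow> s \<in> ideal_gen (set (take i xs)))
     \<and> ideal_gen (set xs) \<noteq> UNIV"

definition depth :: "'a::comm_ring_1 set \<Rightarrow> enat" where
  "depth I = Sup {enat (length xs) | xs. set xs \<subseteq> I \<and> regular_sequence xs}"

text \<open>Cohen--Macaulayness as in Eisenbud's \<^emph>\<open>Commutative Algebra\<close>, Section 18.2: the depth of
  every maximal ideal on the ring equals its height (codimension).\<close>

definition cohen_macaulay :: "'a::comm_ring_1 itself \<Rightarrow> bool" where
  "cohen_macaulay R \<longleftrightarrow> noetherian R \<and> (\<forall>M :: 'a set. maximal_ideal M \<longrightarrow> depth M = height M)"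

definition normal_domain :: "'a::idom itself \<Rightarrow> bool" where
  "normal_domain _ \<longleftrightarrow>
     (\<forall>y :: 'a fract. (\<exists>f :: 'a poly. lead_coeff f = 1 \<and> poly (map_poly to_fract f) y = 0)
        \<longrightarrow> y \<in> range to_fract)"


section \<open>Graded algebras\<close>

definition additive_subgroup :: "'a::ab_group_add set \<Rightarrow> bool" where
  "additive_subgroup A \<longleftrightarrow> 0 \<in> A \<and> (\<forall>a\<in>A. \<forall>b\<in>A. a - b \<in> A)"

definition nat_grading :: "(nat \<Rightarrow> 'a::comm_ring_1 set) \<Rightarrow> bool" where
  "nat_grading gr \<longleftrightarrow>
     (\<forall>i. additive_subgroup (gr i)) \<and>
     (\<forall>s. \<exists>!f. (\<forall>i. f i \<in> gr i) \<and> finite {i. f i \<noteq> 0} \<and> s = (\<Sum>i | f i \<noteq> 0. f i)) \<and>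
     1 \<in> gr 0 \<and>
     (\<forall>i j. \<forall>a\<in>gr i. \<forall>b\<in>gr j. a * b \<in> gr (i + j))"

definition is_subring :: "'a::comm_ring_1 set \<Rightarrow> bool" where
  "is_subring A \<longleftrightarrow> additive_subgroup A \<and> 1 \<in> A \<and> (\<forall>a\<in>A. \<forall>b\<in>A. a * b \<in> A)"

definition is_subfield :: "'a::comm_ring_1 set \<Rightarrow> bool" where
  "is_subfield k \<longleftrightarrow> is_subring k \<and> (1::'a) \<noteq> 0 \<and> (\<forall>a\<in>k. a \<noteq> 0 \<longrightarrow> (\<exists>b\<in>k. a * b = 1))"

definition finitely_generated_algebra :: "'a::comm_ring_1 set \<Rightarrow> bool" where
  "finitely_generated_algebra k \<longleftrightarrow> (\<exists>G. finite G \<and> is_subring hull (k \<union> G) = UNIV)"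

definition irrelevant_ideal :: "(nat \<Rightarrow> 'a::comm_ring_1 set) \<Rightarrow> 'a set" where
  "irrelevant_ideal gr = ideal_gen (\<Union>i\<in>{0<..}. gr i)"

text \<open>A homogeneous system of parameters \<open>x 0, \<dots>, x (d - 1)\<close>, where \<open>deg i\<close> is the degree
  of \<open>x i\<close>; its length \<open>d\<close> is the Krull dimension, and the radical of the ideal it
  generates is the homogeneous maximal ideal.\<close>

definition homogeneous_sop ::
    "(nat \<Rightarrow> 'a::comm_ring_1 set) \<Rightarrow> nat \<Rightarrow> (nat \<Rightarrow> 'a) \<Rightarrow> (nat \<Rightarrow> nat) \<Rightarrow> bool" where
  "homogeneous_sop gr d x deg \<longleftrightarrow>
     krull_dim TYPE('a) = enat d \<and>
     (\<forall>i<d. 0 < deg i \<and> x i \<in> gr (deg i)) \<and>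
     {s. \<exists>m. s ^ m \<in> ideal_gen (x ` {..<d})} = irrelevant_ideal gr"


section \<open>Tight closure of ideals and test elements\<close>

definition frobenius_power :: "'a::comm_ring_1 set \<Rightarrow> nat \<Rightarrow> 'a set" where
  "frobenius_power I q = ideal_gen ((\<lambda>a. a ^ q) ` I)"

definition tight_closure :: "'a::idom set \<Rightarrow> 'a set" where
  "tight_closure I =
     {z. \<exists>c. c \<noteq> 0 \<and> (\<forall>\<^sub>F e in sequentially. c * z ^ (CHAR('a) ^ e) \<in> frobenius_power I (CHAR('a) ^ e))}"

definition test_element :: "'a::idom \<Rightarrow> bool" where
  "test_element c \<longleftrightarrow> c \<noteq> 0 \<and>
     (\<forall>I. ideal I \<longrightarrow> (\<forall>z\<in>tight_closure I. \<forall>e.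
        c * z ^ (CHAR('a) ^ e) \<in> frobenius_power I (CHAR('a) ^ e)))"


section \<open>Top local cohomology by the Cech complex\<close>

text \<open>Since the ring is a domain, all localisations in the Cech complex on \<open>x 0, \<dots>, x (d - 1)\<close>
  are subrings of the fraction field: \<open>cech_loc x J\<close> is the ring with the product of
  the \<open>x i\<close>, \<open>i \<in> J\<close>, inverted (the \<open>x i\<close> being nonzero).\<close>

definition cech_loc :: "(nat \<Rightarrow> 'a::idom) \<Rightarrow> nat set \<Rightarrow> 'a fract set" where
  "cech_loc x J = {Fract r ((\<Prod>i\<in>J. x i) ^ k) | r k. True}"

text \<open>The image of the last differential
  \<open>(\<Oplus>i<d. cech_loc x ({..<d} - {i})) \<rightarrow> cech_loc x {..<d}\<close>.\<close>

definition cech_boundaries :: "(nat \<Rightarrow> 'a::idom) \<Rightarrow> nat \<Rightarrow> 'a fract set" where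
  "cech_boundaries x d =
     {(\<Sum>i<d. (-1) ^ i * y i) | y. \<forall>i<d. y i \<in> cech_loc x ({..<d} - {i})}"

text \<open>The \<open>d\<close>-th local cohomology is the quotient of \<open>cech_loc x {..<d}\<close> by
  \<open>cech_boundaries x d\<close>; its elements are represented as cosets.\<close>

definition lc_class :: "(nat \<Rightarrow> 'a::idom) \<Rightarrow> nat \<Rightarrow> 'a fract \<Rightarrow> 'a fract set" where
  "lc_class x d u = u +o cech_boundaries x d"

definition local_cohomology :: "(nat \<Rightarrow> 'a::idom) \<Rightarrow> nat \<Rightarrow> 'a fract set set" where
  "local_cohomology x d = lc_class x d ` cech_loc x {..<d}"

text \<open>Maps on cosets are defined by applying the map to all representatives; the resulting
  classes coincide.\<close>

definition lc_scale :: "(nat \<Rightarrow> 'a::idom) \<Rightarrow> nat \<Rightarrow> 'a \<Rightarrow> 'a fract set \<Rightarrow> 'a fract set" where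
  "lc_scale x d c \<eta> = (\<Union>u\<in>\<eta>. lc_class x d (to_fract c * u))"

definition lc_frobenius :: "(nat \<Rightarrow> 'a::idom) \<Rightarrow> nat \<Rightarrow> 'a fract set \<Rightarrow> 'a fract set" where
  "lc_frobenius x d \<eta> = (\<Union>u\<in>\<eta>. lc_class x d (u ^ CHAR('a)))"

text \<open>The fractions \<open>r / (x 0 \<cdots> x (d - 1)) ^ k\<close> of degree \<open>j\<close>, where \<open>r\<close> is
  homogeneous of degree \<open>j + k * (\<Sum>i<d. deg i)\<close> (so \<open>r = 0\<close> if this is negative).\<close>

definition cech_component ::
    "(nat \<Rightarrow> 'a::idom set) \<Rightarrow> (nat \<Rightarrow> 'a) \<Rightarrow> (nat \<Rightarrow> nat) \<Rightarrow> nat \<Rightarrow> int \<Rightarrow> 'a fract set" where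
  "cech_component gr x deg d j =
     {Fract r ((\<Prod>i<d. x i) ^ k) | r k.
        let m = j + int (k * (\<Sum>i<d. deg i)) in r \<in> (if 0 \<le> m then gr (nat m) else {0})}"

text \<open>The direct sum of the graded components of local cohomology of degree in \<open>T\<close>.\<close>

definition lc_part ::
    "(nat \<Rightarrow> 'a::idom set) \<Rightarrow> (nat \<Rightarrow> 'a) \<Rightarrow> (nat \<Rightarrow> nat) \<Rightarrow> nat \<Rightarrow> int set \<Rightarrow> 'a fract set set" where
  "lc_part gr x deg d T =
     {lc_class x d (\<Sum>j\<in>J. u j) | J u.
        finite J \<and> J \<subseteq> T \<and> (\<forall>j\<in>J. u j \<in> cech_component gr x deg d j)}"

definition lc_tight_closure_zero :: "(nat \<Rightarrow> 'a::idom) \<Rightarrow> nat \<Rightarrow> 'a fract set set" where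
  "lc_tight_closure_zero x d =
     {\<eta> \<in> local_cohomology x d.
        \<exists>c. c \<noteq> 0 \<and> (\<forall>e. lc_scale x d c ((lc_frobenius x d ^^ e) \<eta>) = lc_class x d 0)}"

end

theory Submission
  imports Defs
begin

text \<open>Write \<open>H\<close> for the top local cohomology and \<open>p\<close> for the characteristic. The tight closure of
  zero in \<open>H\<close> is stable under the Frobenius action, and it is annihilated by a power of each
  parameter: because the parameters form a regular sequence, the class of a fraction
  \<open>r / (x\<^sub>0 \<cdots> x\<^sub>d\<^sub>-\<^sub>1)\<^sup>k\<close> vanishes exactly when \<open>r\<close> lies in \<open>(x\<^sub>0\<^sup>k, \<dots>, x\<^sub>d\<^sub>-\<^sub>1\<^sup>k)\<close>, so the class lies in the
  tight closure of zero only if \<open>r\<close> lies in the tight closure of that ideal, and the test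
  elements \<open>x\<^sub>i\<^sup>N\<close> then annihilate all Frobenius images of the class, for one \<open>N\<close> independent of the
  class. The elements of \<open>H\<close> annihilated by all \<open>x\<^sub>i\<^sup>N\<close> are represented by fractions with denominator
  \<open>(x\<^sub>0 \<cdots> x\<^sub>d\<^sub>-\<^sub>1)\<^sup>N\<close> and therefore live in degrees bounded below (\<open>colon_power_ideal\<close>).

  Now take a homogeneous component of degree \<open>j \<le> -n\<close> of an element of the tight closure of zero.
  The relations above are homogeneous, so they hold for the component. Its \<open>e\<close>-th Frobenius image
  has degree \<open>j p\<^sup>e\<close>, which is below the bound for large \<open>e\<close>, hence this image is zero. All
  its Frobenius images have degree at most \<open>-n\<close>, where Frobenius is injective, so the
  component itself is zero (\<open>tight_closure_low_degree\<close>, \<open>frobenius_injective_power\<close>).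

  That the parameters form a regular sequence, in any order and with arbitrary exponents, takes two
  steps. Cohen--Macaulayness provides a regular sequence in the homogeneous maximal ideal
  whose length is the height of that ideal; this height is the Krull dimension, because the
  height of a prime exceeds that of its largest homogeneous subideal by at most one
  (\<open>chain_to_hpart\<close>, \<open>regular_sequence_in_irrelevant\<close>). A Koszul argument then transfers regularity from that
  sequence to every sequence of the same length generating an ideal with the same
  radical (\<open>regular_sequence_imp_nonzerodivisor\<close>).\<close>

section \<open>Ideals\<close>

interpretation regular_module: module "(*) :: 'a::comm_ring_1 \<Rightarrow> 'a \<Rightarrow> 'a"
  by unfold_locales (simp_all add: algebra_simps)

(* For the regular module this rule is associativity, oriented against mult.assoc. *)
declare regular_module.scale_scale [simp del]

lemmas ideal_0 = regular_module.subspace_0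
  and ideal_add = regular_module.subspace_add
  and ideal_diff = regular_module.subspace_diff
  and ideal_mult = regular_module.subspace_scale
  and ideal_sum = regular_module.subspace_sum
  and ideal_gen_minimal = regular_module.span_minimal
  and ideal_gen_mono = regular_module.span_mono
  and ideal_gen_base = regular_module.span_base

lemma ideal_ideal_gen [simp]: "ideal (ideal_gen S)"
  by (rule regular_module.subspace_span)

lemma ideal_eq_UNIV_iff:
  assumes "ideal I"
  shows "I = UNIV \<longleftrightarrow> 1 \<in> I"
proof
  assume "1 \<in> I"
  then have "a * 1 \<in> I" for a
    using assms ideal_mult by blast
  then show "I = UNIV" by auto
qed simp

lemma ideal_gen_image:
  assumes "finite I"
  shows "s \<in> ideal_gen (f ` I) \<longleftrightarrow> (\<exists>c. s = (\<Sum>i\<in>I. c i * f i))"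
proof
  assume "s \<in> ideal_gen (f ` I)"
  then show "\<exists>c. s = (\<Sum>i\<in>I. c i * f i)"
  proof (induction rule: regular_module.span_induct_alt)
    case base
    show ?case by (rule exI[of _ "\<lambda>_. 0"]) simp
  next
    case (step a y z)
    then obtain c i where c: "z = (\<Sum>i\<in>I. c i * f i)" and i: "i \<in> I" "y = f i" by auto
    have "(\<Sum>j\<in>I. (c j + (if j = i then a else 0)) * f j)
        = z + (\<Sum>j\<in>I. if j = i then a * f j else 0)"
      unfolding c by (simp add: distrib_right sum.distrib if_distrib[of "\<lambda>u. u * _"] cong: if_cong)
    also have "\<dots> = a * y + z" using i assms by simp
    finally show ?case by metis
  qed
next
  assume "\<exists>c. s = (\<Sum>i\<in>I. c i * f i)"
  then show "s \<in> ideal_gen (f ` I)"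
    by (auto intro!: ideal_sum ideal_mult intro: ideal_gen_base)
qed

lemma ideal_radical:
  assumes "ideal I"
  shows "ideal {s. \<exists>m. s ^ m \<in> I}"
proof (rule regular_module.subspaceI)
  show "0 \<in> {s. \<exists>m. s ^ m \<in> I}"
    using ideal_0[OF assms] by (auto intro!: exI[of _ 1])
next
  fix a b
  assume "a \<in> {s. \<exists>m. s ^ m \<in> I}" "b \<in> {s. \<exists>m. s ^ m \<in> I}"
  then obtain k l where k: "a ^ k \<in> I" and l: "b ^ l \<in> I" by auto
  have "of_nat (k + l choose i) * a ^ i * b ^ (k + l - i) \<in> I" for i
  proof (cases "k \<le> i")
    case True
    then have eq: "a ^ i = a ^ (i - k) * a ^ k" by (simp flip: power_add)
    have "of_nat (k + l choose i) * a ^ i * b ^ (k + l - i)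
        = (of_nat (k + l choose i) * b ^ (k + l - i) * a ^ (i - k)) * a ^ k"
      by (subst eq) (simp add: ac_simps)
    then show ?thesis using ideal_mult[OF assms k] by metis
  next
    case False
    then have eq: "b ^ (k + l - i) = b ^ (k - i) * b ^ l" by (simp flip: power_add)
    have "of_nat (k + l choose i) * a ^ i * b ^ (k + l - i)
        = (of_nat (k + l choose i) * a ^ i * b ^ (k - i)) * b ^ l"
      by (subst eq) (simp add: ac_simps)
    then show ?thesis using ideal_mult[OF assms l] by metis
  qed
  then have "(a + b) ^ (k + l) \<in> I"
    unfolding binomial_ring by (intro ideal_sum[OF assms]) auto
  then show "a + b \<in> {s. \<exists>m. s ^ m \<in> I}" by blast
next
  fix c a
  assume "a \<in> {s. \<exists>m. s ^ m \<in> I}"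
  then show "c * a \<in> {s. \<exists>m. s ^ m \<in> I}"
    using ideal_mult[OF assms] by (auto simp: power_mult_distrib)
qed


section \<open>Homogeneous components\<close>

lemma additive_subgroup_simps:
  assumes "additive_subgroup A"
  shows additive_subgroup_0: "0 \<in> A"
    and additive_subgroup_diff: "a \<in> A \<Longrightarrow> b \<in> A \<Longrightarrow> a - b \<in> A"
    and additive_subgroup_minus: "a \<in> A \<Longrightarrow> - a \<in> A"
    and additive_subgroup_add: "a \<in> A \<Longrightarrow> b \<in> A \<Longrightarrow> a + b \<in> A"
proof -
  show z: "0 \<in> A" and d: "a \<in> A \<Longrightarrow> b \<in> A \<Longrightarrow> a - b \<in> A" for a b
    using assms by (auto simp: additive_subgroup_def)
  show n: "a \<in> A \<Longrightarrow> - a \<in> A" for a using d[OF z, of a] by simp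
  show "a \<in> A \<Longrightarrow> b \<in> A \<Longrightarrow> a + b \<in> A" using d[OF _ n, of a b] by simp
qed

locale graded_ring =
  fixes gr :: "nat \<Rightarrow> 'a::comm_ring_1 set"
  assumes nat_grading: "nat_grading gr"
begin

lemma gr_subgroup: "additive_subgroup (gr i)"
  using nat_grading by (auto simp: nat_grading_def)

lemmas gr_0 = additive_subgroup_0[OF gr_subgroup]
  and gr_add = additive_subgroup_add[OF gr_subgroup]

lemma one_in_gr: "1 \<in> gr 0"
  and gr_mult: "a \<in> gr i \<Longrightarrow> b \<in> gr j \<Longrightarrow> a * b \<in> gr (i + j)"
  using nat_grading by (auto simp: nat_grading_def)

lemma gr_power: "a \<in> gr i \<Longrightarrow> a ^ m \<in> gr (m * i)"
  by (induction m) (auto intro: one_in_gr gr_mult)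

lemma gr_prod:
  assumes "finite I" "\<And>i. i \<in> I \<Longrightarrow> f i \<in> gr (w i)"
  shows "(\<Prod>i\<in>I. f i) \<in> gr (\<Sum>i\<in>I. w i)"
  using assms by (induction I) (auto intro: one_in_gr gr_mult)

definition hcomp :: "'a \<Rightarrow> nat \<Rightarrow> 'a" where
  "hcomp s = (THE f. (\<forall>i. f i \<in> gr i) \<and> finite {i. f i \<noteq> 0} \<and> s = (\<Sum>i | f i \<noteq> 0. f i))"

lemma hcomp:
  shows hcomp_in_gr: "hcomp s i \<in> gr i"
    and finite_hcomp: "finite {i. hcomp s i \<noteq> 0}"
    and sum_hcomp: "s = (\<Sum>i | hcomp s i \<noteq> 0. hcomp s i)"
proof -
  have "\<exists>!f. (\<forall>i. f i \<in> gr i) \<and> finite {i. f i \<noteq> 0} \<and> s = (\<Sum>i | f i \<noteq> 0. f i)"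
    using nat_grading unfolding nat_grading_def by blast
  from theI'[OF this, folded hcomp_def]
  show "hcomp s i \<in> gr i" "finite {i. hcomp s i \<noteq> 0}"
    "s = (\<Sum>i | hcomp s i \<noteq> 0. hcomp s i)" by auto
qed

lemma hcomp_eqI:
  assumes "\<And>i. f i \<in> gr i" "finite I" "\<And>i. i \<notin> I \<Longrightarrow> f i = 0" "s = (\<Sum>i\<in>I. f i)"
  shows "hcomp s = f"
proof -
  have "{i. f i \<noteq> 0} \<subseteq> I" using assms by auto
  then have "finite {i. f i \<noteq> 0}" "s = (\<Sum>i | f i \<noteq> 0. f i)"
    unfolding assms(4) by (auto intro: finite_subset assms(2) sum.mono_neutral_right[OF assms(2)])
  moreover have "\<exists>!f. (\<forall>i. f i \<in> gr i) \<and> finite {i. f i \<noteq> 0} \<and> s = (\<Sum>i | f i \<noteq> 0. f i)"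
    using nat_grading unfolding nat_grading_def by blast
  ultimately show ?thesis
    unfolding hcomp_def using assms(1) by (intro the1_equality) auto
qed

lemma sum_hcomp_superset:
  assumes "finite I" "{i. hcomp s i \<noteq> 0} \<subseteq> I"
  shows "(\<Sum>i\<in>I. hcomp s i) = s"
  using sum.mono_neutral_left[OF assms, of "hcomp s"] sum_hcomp[of s] by auto

lemma hcomp_add: "hcomp (s + t) i = hcomp s i + hcomp t i"
proof -
  let ?I = "{i. hcomp s i \<noteq> 0} \<union> {i. hcomp t i \<noteq> 0}"
  have "hcomp (s + t) = (\<lambda>i. hcomp s i + hcomp t i)"
  proof (rule hcomp_eqI)
    show "finite ?I" by (simp add: finite_hcomp)
    then show "s + t = (\<Sum>i\<in>?I. hcomp s i + hcomp t i)"
      by (simp add: sum.distrib sum_hcomp_superset)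
  qed (auto intro: gr_add hcomp_in_gr)
  then show ?thesis by simp
qed

lemma hcomp_homogeneous:
  assumes "a \<in> gr j"
  shows "hcomp a i = (if i = j then a else 0)"
proof -
  have "hcomp a = (\<lambda>i. if i = j then a else 0)"
    by (rule hcomp_eqI[of _ "{j}"]) (use assms in \<open>auto simp: gr_0\<close>)
  then show ?thesis by simp
qed

lemma hcomp_0 [simp]: "hcomp 0 i = 0"
  using hcomp_homogeneous[OF gr_0, of i i] by simp

lemma hcomp_minus: "hcomp (- s) i = - hcomp s i"
  using hcomp_add[of s "- s" i] by (simp add: minus_unique)

lemma hcomp_diff: "hcomp (s - t) i = hcomp s i - hcomp t i"
  using hcomp_add[of s "- t" i] by (simp add: hcomp_minus)

lemma hcomp_sum: "hcomp (\<Sum>k\<in>A. f k) i = (\<Sum>k\<in>A. hcomp (f k) i)"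
  by (induction A rule: infinite_finite_induct) (auto simp: hcomp_add)

lemma hcomp_mult_homogeneous:
  assumes "a \<in> gr j"
  shows "hcomp (a * s) i = (if j \<le> i then a * hcomp s (i - j) else 0)"
proof -
  have "a * s = (\<Sum>k | hcomp s k \<noteq> 0. a * hcomp s k)"
    by (subst (1) sum_hcomp[of s]) (rule sum_distrib_left)
  also have "hcomp \<dots> i = (\<Sum>k | hcomp s k \<noteq> 0. if i = j + k then a * hcomp s k else 0)"
    unfolding hcomp_sum using assms
    by (intro sum.cong refl) (simp add: hcomp_homogeneous gr_mult hcomp_in_gr)
  also have "\<dots> = (\<Sum>k | hcomp s k \<noteq> 0. if k = i - j then (if j \<le> i then a * hcomp s k else 0) else 0)"
    by (intro sum.cong) auto
  also have "\<dots> = (if j \<le> i then a * hcomp s (i - j) else 0)"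
    using finite_hcomp[of s] by auto
  finally show ?thesis .
qed

lemma hcomp_mult:
  assumes "{i. hcomp s i \<noteq> 0} \<subseteq> I" "finite I"
  shows "hcomp (s * t) k = (\<Sum>i\<in>I. if i \<le> k then hcomp s i * hcomp t (k - i) else 0)"
proof -
  have "s * t = (\<Sum>i\<in>I. hcomp s i * t)"
    using sum_hcomp_superset[OF assms(2,1)] by (simp flip: sum_distrib_right)
  then show ?thesis
    by (simp add: hcomp_sum hcomp_mult_homogeneous[OF hcomp_in_gr])
qed

lemma ideal_gen_homogeneous:
  assumes G: "\<And>g. g \<in> G \<Longrightarrow> \<exists>j. g \<in> gr j" and s: "s \<in> ideal_gen G"
  shows "hcomp s i \<in> ideal_gen G"
  using s
proof (induction rule: regular_module.span_induct_alt)
  case base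
  then show ?case by (simp add: ideal_0)
next
  case (step c g s)
  obtain j where "g \<in> gr j" using G step by blast
  then have "hcomp (c * g) i \<in> ideal_gen G"
    using step(1) by (simp add: hcomp_mult_homogeneous mult.commute[of c] ideal_0)
      (simp add: mult.commute[of g] ideal_mult ideal_gen_base)
  then show ?case using step by (simp add: hcomp_add ideal_add)
qed

end

section \<open>Koszul homology and regular sequences\<close>

text \<open>A regular sequence \<open>ys\<close> in the radical of \<open>(z\<^sub>0, \<dots>, z\<^sub>n\<^sub>-\<^sub>1)\<close> whose length
  is the number of the \<open>z\<^sub>i\<close> forces the \<open>z\<^sub>i\<close> to behave like a regular sequence, in any order.
  Koszul homology transports this from \<open>ys\<close> to \<open>z\<close>: it vanishes above degree \<open>n\<close> for trivial
  reasons, every element of the ideal \<open>(z)\<close> annihilates it, and each nonzerodivisor taken from the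
  radical of \<open>(z)\<close> lowers the bound for vanishing by one, so that after \<open>n\<close> steps the first
  homology is zero.

  A Koszul chain is a function on subsets of \<open>{..<n}\<close>; its value at \<open>T\<close> is the coefficient of
  the exterior product of the basis vectors indexed by \<open>T\<close>. Chains of all degrees share one
  type, and statements about degree \<open>m\<close> look at the subsets of cardinality \<open>m\<close> only.\<close>

definition koszul_sign :: "nat \<Rightarrow> nat set \<Rightarrow> 'a::comm_ring_1" where
  "koszul_sign i T = (- 1) ^ card {k \<in> T. k < i}"

definition koszul_diff :: "nat \<Rightarrow> (nat \<Rightarrow> 'a) \<Rightarrow> (nat set \<Rightarrow> 'a::comm_ring_1) \<Rightarrow> nat set \<Rightarrow> 'a" where
  "koszul_diff n z f T = (\<Sum>i\<in>{..<n} - T. koszul_sign i T * z i * f (insert i T))"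

lemma koszul_sign_insert:
  assumes "finite T" "i \<notin> T"
  shows "koszul_sign j (insert i T) = (if i < j then - koszul_sign j T else koszul_sign j T)"
proof -
  have "{k \<in> insert i T. k < j} = (if i < j then insert i {k \<in> T. k < j} else {k \<in> T. k < j})"
    by auto
  then show ?thesis using assms by (simp add: koszul_sign_def)
qed

lemma koszul_sign_insert_self: "koszul_sign i (insert i T) = koszul_sign i T"
  unfolding koszul_sign_def by (rule arg_cong[of _ _ "\<lambda>A. _ ^ card A"]) auto

lemma koszul_sign_square: "koszul_sign i T * koszul_sign i T = 1"
  by (simp add: koszul_sign_def flip: power_add mult_2)

lemma sum_antisymmetric_eq_0:
  fixes t :: "'i \<Rightarrow> 'i \<Rightarrow> 'a::ab_group_add"
  assumes "finite A" "\<And>i j. i \<in> A \<Longrightarrow> j \<in> A \<Longrightarrow> i \<noteq> j \<Longrightarrow> t i j = - t j i"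
  shows "(\<Sum>i\<in>A. \<Sum>j\<in>A - {i}. t i j) = 0"
  using assms
proof (induction A)
  case (insert a A)
  have "(\<Sum>j\<in>insert a A - {i}. t i j) = t i a + (\<Sum>j\<in>A - {i}. t i j)" if "i \<in> A" for i
  proof -
    have "insert a A - {i} = insert a (A - {i})" using that insert.hyps by auto
    then show ?thesis using insert.hyps by simp
  qed
  then have "(\<Sum>i\<in>insert a A. \<Sum>j\<in>insert a A - {i}. t i j)
      = (\<Sum>j\<in>A. t a j) + (\<Sum>i\<in>A. t i a) + (\<Sum>i\<in>A. \<Sum>j\<in>A - {i}. t i j)"
    using insert.hyps by (simp add: sum.distrib add.assoc)
  also have "(\<Sum>i\<in>A. t i a) = - (\<Sum>j\<in>A. t a j)"
    unfolding sum_negf[symmetric] using insert.hyps by (intro sum.cong insert.prems) auto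
  also have "(\<Sum>i\<in>A. \<Sum>j\<in>A - {i}. t i j) = 0"
    by (rule insert.IH) (use insert.prems in blast)
  finally show ?case by simp
qed simp

text \<open>The summands for the two orders of removing \<open>i\<close> and \<open>j\<close> carry opposite signs. They are
  paired off explicitly, because equality with its own negative does not make a sum vanish in
  characteristic two.\<close>

lemma koszul_diff_diff:
  assumes "T \<subseteq> {..<n}"
  shows "koszul_diff n z (koszul_diff n z f) T = 0"
proof -
  have fin: "finite T" using assms finite_subset by blast
  define t where "t i j = koszul_sign i T * z i * (koszul_sign j (insert i T) * z j * f (insert j (insert i T)))"
    for i j
  have "{..<n} - insert i T = ({..<n} - T) - {i}" for i by auto
  then have "koszul_diff n z (koszul_diff n z f) T = (\<Sum>i\<in>{..<n} - T. \<Sum>j\<in>({..<n} - T) - {i}. t i j)"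
    by (simp add: koszul_diff_def t_def sum_distrib_left)
  also have "\<dots> = 0"
  proof (rule sum_antisymmetric_eq_0)
    fix i j assume ij: "i \<in> {..<n} - T" "j \<in> {..<n} - T" "i \<noteq> j"
    have "koszul_sign i T * koszul_sign j (insert i T) = - (koszul_sign j T * koszul_sign i (insert j T) :: 'a)"
      using ij fin by (cases "i < j") (simp_all add: koszul_sign_insert mult.commute)
    moreover have "t i j = (koszul_sign i T * koszul_sign j (insert i T)) * (z i * (z j * f (insert j (insert i T))))"
      "t j i = (koszul_sign j T * koszul_sign i (insert j T)) * (z i * (z j * f (insert j (insert i T))))"
      by (simp_all add: t_def insert_commute ac_simps)
    ultimately show "t i j = - t j i" by simp
  qed simp
  finally show ?thesis .
qed

lemma koszul_diff_minus: "koszul_diff n z (\<lambda>S. f S - g S) T = koszul_diff n z f T - koszul_diff n z g T"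
  by (simp add: koszul_diff_def right_diff_distrib sum_subtractf)

lemma koszul_diff_scale: "koszul_diff n z (\<lambda>S. c * f S) T = c * koszul_diff n z f T"
  by (simp add: koszul_diff_def sum_distrib_left ac_simps)

lemma koszul_diff_sum:
  "koszul_diff n z (\<lambda>S. \<Sum>i\<in>A. c i * f i S) T = (\<Sum>i\<in>A. c i * koszul_diff n z (f i) T)"
proof -
  have "koszul_diff n z (\<lambda>S. \<Sum>i\<in>A. c i * f i S) T
      = (\<Sum>j\<in>{..<n} - T. \<Sum>i\<in>A. c i * (koszul_sign j T * z j * f i (insert j T)))"
    by (simp add: koszul_diff_def sum_distrib_left ac_simps)
  also have "\<dots> = (\<Sum>i\<in>A. \<Sum>j\<in>{..<n} - T. c i * (koszul_sign j T * z j * f i (insert j T)))"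
    by (rule sum.swap)
  finally show ?thesis by (simp add: koszul_diff_def sum_distrib_left)
qed

lemma koszul_diff_in_ideal:
  assumes "ideal J" "\<And>i. i \<in> {..<n} - T \<Longrightarrow> f (insert i T) \<in> J"
  shows "koszul_diff n z f T \<in> J"
  unfolding koszul_diff_def using assms by (intro ideal_sum ideal_mult) auto

text \<open>Exterior multiplication by the \<open>i\<close>-th basis vector.\<close>

definition wedge :: "nat \<Rightarrow> (nat set \<Rightarrow> 'a::comm_ring_1) \<Rightarrow> nat set \<Rightarrow> 'a" where
  "wedge i f T = (if i \<in> T then koszul_sign i T * f (T - {i}) else 0)"

text \<open>Exterior multiplication by a basis vector is a contracting homotopy for multiplication by
  \<open>z i\<close>; this is why the ideal generated by the \<open>z i\<close> annihilates Koszul homology.\<close>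

lemma koszul_homotopy:
  assumes T: "T \<subseteq> {..<n}" and i: "i < n"
  shows "koszul_diff n z (wedge i f) T + wedge i (koszul_diff n z f) T = z i * f T"
proof (cases "i \<in> T")
  case False
  have "koszul_diff n z (wedge i f) T
      = (\<Sum>j\<in>{..<n} - T. if j = i then koszul_sign i T * z i * (koszul_sign i T * f T) else 0)"
    unfolding koszul_diff_def wedge_def using False
    by (intro sum.cong) (auto simp: koszul_sign_insert_self)
  also have "\<dots> = (koszul_sign i T * koszul_sign i T) * z i * f T"
    using i False by (simp add: ac_simps)
  finally show ?thesis using False by (simp add: wedge_def koszul_sign_square)
next
  case True
  define U where "U = T - {i}"
  have U: "i \<notin> U" "T = insert i U" "finite U" "T - {i} = U"
    using True T finite_subset[of T "{..<n}"] by (auto simp: U_def)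
  have sgn: "koszul_sign j T * koszul_sign i (insert j T) = - (koszul_sign i T * koszul_sign j U :: 'a)"
    if "j \<notin> T" for j
    using that U by (cases "i < j") (auto simp: koszul_sign_insert koszul_sign_insert_self ac_simps)
  have "koszul_diff n z (wedge i f) T
      = (\<Sum>j\<in>{..<n} - T. (koszul_sign j T * koszul_sign i (insert j T)) * (z j * f (insert j U)))"
    unfolding koszul_diff_def
  proof (rule sum.cong)
    fix j assume "j \<in> {..<n} - T"
    moreover from this have "insert j T - {i} = insert j U" using True U by auto
    ultimately show "koszul_sign j T * z j * wedge i f (insert j T)
        = (koszul_sign j T * koszul_sign i (insert j T)) * (z j * f (insert j U))"
      using True by (simp add: wedge_def ac_simps)
  qed simp
  also have "\<dots> = - (\<Sum>j\<in>{..<n} - T. koszul_sign i T * (koszul_sign j U * z j * f (insert j U)))"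
    unfolding sum_negf[symmetric] by (intro sum.cong) (simp_all add: sgn mult.assoc)
  finally have *: "koszul_diff n z (wedge i f) T
      = - (\<Sum>j\<in>{..<n} - T. koszul_sign i T * (koszul_sign j U * z j * f (insert j U)))" .
  have eq: "{..<n} - U = insert i ({..<n} - T)" using i True by (auto simp: U_def)
  have "koszul_diff n z f U
      = koszul_sign i U * z i * f T + (\<Sum>j\<in>{..<n} - T. koszul_sign j U * z j * f (insert j U))"
    unfolding koszul_diff_def eq using True by (simp flip: U(2))
  then have "wedge i (koszul_diff n z f) T = (koszul_sign i T * koszul_sign i U) * (z i * f T)
      + (\<Sum>j\<in>{..<n} - T. koszul_sign i T * (koszul_sign j U * z j * f (insert j U)))"
    using True U(4) by (simp add: wedge_def distrib_left sum_distrib_left ac_simps)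
  also have "koszul_sign i T * koszul_sign i U = (1 :: 'a)"
    using U(2) koszul_sign_insert_self koszul_sign_square by metis
  finally show ?thesis using * by simp
qed

text \<open>Vanishing of the \<open>m\<close>-th Koszul homology with coefficients in the ring modulo \<open>J\<close>. Working
  with congruences modulo \<open>J\<close> avoids forming the quotient ring.\<close>

definition koszul_exact :: "nat \<Rightarrow> (nat \<Rightarrow> 'a) \<Rightarrow> 'a::comm_ring_1 set \<Rightarrow> nat \<Rightarrow> bool" where
  "koszul_exact n z J m \<longleftrightarrow>
     (\<forall>f. (\<forall>T\<subseteq>{..<n}. Suc (card T) = m \<longrightarrow> koszul_diff n z f T \<in> J) \<longrightarrow>
       (\<exists>g. \<forall>T\<subseteq>{..<n}. card T = m \<longrightarrow> f T - koszul_diff n z g T \<in> J))"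

lemma ideal_annihilates_koszul:
  assumes J: "ideal J" and w: "w \<in> ideal_gen (z ` {..<n})"
    and f: "\<And>T. T \<subseteq> {..<n} \<Longrightarrow> Suc (card T) = m \<Longrightarrow> koszul_diff n z f T \<in> J"
  shows "\<exists>g. \<forall>T\<subseteq>{..<n}. card T = m \<longrightarrow> w * f T - koszul_diff n z g T \<in> J"
proof -
  obtain c where c: "w = (\<Sum>i<n. c i * z i)" using w by (auto simp: ideal_gen_image)
  let ?g = "\<lambda>S. \<Sum>i<n. c i * wedge i f S"
  have "w * f T - koszul_diff n z ?g T \<in> J" if T: "T \<subseteq> {..<n}" "card T = m" for T
  proof -
    have "w * f T - koszul_diff n z ?g T = (\<Sum>i<n. c i * (z i * f T - koszul_diff n z (wedge i f) T))"
      by (simp add: koszul_diff_sum c sum_distrib_right sum_subtractf right_diff_distrib mult.assoc)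
    also have "\<dots> = (\<Sum>i<n. c i * wedge i (koszul_diff n z f) T)"
    proof (rule sum.cong)
      fix i assume "i \<in> {..<n}"
      then have "z i * f T - koszul_diff n z (wedge i f) T = wedge i (koszul_diff n z f) T"
        using koszul_homotopy[OF T(1), of i z f] by (simp add: algebra_simps)
      then show "c i * (z i * f T - koszul_diff n z (wedge i f) T) = c i * wedge i (koszul_diff n z f) T"
        by simp
    qed simp
    also have "\<dots> \<in> J"
    proof (intro ideal_sum ideal_mult J)
      fix i
      have "koszul_diff n z f (T - {i}) \<in> J" if "i \<in> T"
      proof (rule f)
        have "finite T" using T(1) finite_subset by blast
        then show "Suc (card (T - {i})) = m" using that T(2) card.remove by metis
      qed (use T in auto)
      then show "wedge i (koszul_diff n z f) T \<in> J"
        using J by (auto simp: wedge_def ideal_0 ideal_mult)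
    qed
    finally show ?thesis .
  qed
  then show ?thesis by blast
qed

text \<open>This is the long exact sequence of \<open>0 \<rightarrow> R/J \<rightarrow> R/J \<rightarrow> R/(J, y) \<rightarrow> 0\<close>, the first map being
  multiplication by \<open>y\<close>: vanishing of the homology of \<open>R/(J, y)\<close> in degree \<open>m + 1\<close> makes \<open>y\<close> act
  injectively on the homology of \<open>R/J\<close> in degree \<open>m\<close>. Since a power of \<open>y\<close> acts as zero there,
  that homology vanishes.\<close>

lemma koszul_exact_step:
  assumes J: "ideal J" and nzd: "\<And>s. y * s \<in> J \<Longrightarrow> s \<in> J"
    and exact: "koszul_exact n z {s. \<exists>k. s - k * y \<in> J} (Suc m)"
    and y: "y ^ N \<in> ideal_gen (z ` {..<n})"
  shows "koszul_exact n z J m"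
proof -
  (* Injectivity of y on homology: if y f is a boundary modulo J, then so is f. *)
  have cancel: "\<exists>g. \<forall>T\<subseteq>{..<n}. card T = m \<longrightarrow> f T - koszul_diff n z g T \<in> J"
    if g: "\<forall>T\<subseteq>{..<n}. card T = m \<longrightarrow> y * f T - koszul_diff n z g T \<in> J" for f g
  proof -
    have "\<exists>k. koszul_diff n z g T - k * y \<in> J" if "T \<subseteq> {..<n}" "card T = m" for T
    proof -
      have "- 1 * (y * f T - koszul_diff n z g T) \<in> J" using g that J ideal_mult by blast
      then show ?thesis by (intro exI[of _ "f T"]) (simp add: ac_simps)
    qed
    then have "\<exists>h. \<forall>T\<subseteq>{..<n}. card T = Suc m \<longrightarrow> (\<exists>k. g T - koszul_diff n z h T - k * y \<in> J)"
      using exact unfolding koszul_exact_def by auto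
    then obtain h u
      where u: "\<And>T. T \<subseteq> {..<n} \<Longrightarrow> card T = Suc m \<Longrightarrow> g T - koszul_diff n z h T - u T * y \<in> J"
      by metis
    have "f T - koszul_diff n z u T \<in> J" if T: "T \<subseteq> {..<n}" "card T = m" for T
    proof (rule nzd)
      have "koszul_diff n z (\<lambda>S. g S - koszul_diff n z h S - u S * y) T \<in> J"
      proof (rule koszul_diff_in_ideal[OF J])
        fix i assume "i \<in> {..<n} - T"
        moreover have "finite T" using T(1) finite_subset by blast
        ultimately show "g (insert i T) - koszul_diff n z h (insert i T) - u (insert i T) * y \<in> J"
          using T by (intro u) auto
      qed
      also have "koszul_diff n z (\<lambda>S. g S - koszul_diff n z h S - u S * y) T
          = koszul_diff n z g T - y * koszul_diff n z u T"
        using koszul_diff_diff[OF T(1)]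
        by (simp add: koszul_diff_minus koszul_diff_scale mult.commute[of _ y])
      finally have "(y * f T - koszul_diff n z g T) + (koszul_diff n z g T - y * koszul_diff n z u T) \<in> J"
        using g T J ideal_add by blast
      then show "y * (f T - koszul_diff n z u T) \<in> J" by (simp add: algebra_simps)
    qed
    then show ?thesis by blast
  qed
  have cancel_power: "\<exists>g. \<forall>T\<subseteq>{..<n}. card T = m \<longrightarrow> f T - koszul_diff n z g T \<in> J"
    if "\<exists>g. \<forall>T\<subseteq>{..<n}. card T = m \<longrightarrow> y ^ N * f T - koszul_diff n z g T \<in> J" for N f
    using that
  proof (induction N arbitrary: f)
    case (Suc N)
    then have "\<exists>g. \<forall>T\<subseteq>{..<n}. card T = m \<longrightarrow> y ^ N * (y * f T) - koszul_diff n z g T \<in> J"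
      by (simp add: ac_simps)
    from Suc.IH[OF this] show ?case by (elim exE) (rule cancel)
  qed simp
  show ?thesis
    unfolding koszul_exact_def
  proof (intro allI impI)
    fix f
    assume "\<forall>T\<subseteq>{..<n}. Suc (card T) = m \<longrightarrow> koszul_diff n z f T \<in> J"
    then have "\<exists>g. \<forall>T\<subseteq>{..<n}. card T = m \<longrightarrow> y ^ N * f T - koszul_diff n z g T \<in> J"
      by (intro ideal_annihilates_koszul[OF J y]) blast
    then show "\<exists>g. \<forall>T\<subseteq>{..<n}. card T = m \<longrightarrow> f T - koszul_diff n z g T \<in> J"
      by (rule cancel_power)
  qed
qed

lemma koszul_exact_regular_sequence:
  assumes ys: "regular_sequence ys" "length ys = n"
    and rad: "\<And>y. y \<in> set ys \<Longrightarrow> \<exists>N. y ^ N \<in> ideal_gen (z ` {..<n})"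
    and "i \<le> n"
  shows "koszul_exact n z (ideal_gen (set (take i ys))) (Suc i)"
  using \<open>i \<le> n\<close>
proof (induction rule: inc_induct)
  case base
  have "card T \<noteq> Suc n" if "T \<subseteq> {..<n}" for T
    using card_mono[OF _ that] by simp
  then show ?case by (auto simp: koszul_exact_def)
next
  case (step i)
  then have i: "i < length ys" using ys by simp
  obtain N where N: "(ys ! i) ^ N \<in> ideal_gen (z ` {..<n})" using rad[OF nth_mem[OF i]] by auto
  have exact: "koszul_exact n z {s. \<exists>k. s - k * ys ! i \<in> ideal_gen (set (take i ys))} (Suc (Suc i))"
    using step.IH i by (simp add: take_Suc_conv_app_nth regular_module.span_insert)
  have nzd: "s \<in> ideal_gen (set (take i ys))" if "ys ! i * s \<in> ideal_gen (set (take i ys))" for s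
    using ys(1) i that unfolding regular_sequence_def by blast
  show ?case by (rule koszul_exact_step[OF ideal_ideal_gen nzd exact N])
qed

text \<open>A relation \<open>z i * s = \<Sum> z j * c j\<close> is a Koszul cycle of degree one with coefficient \<open>s\<close>
  at \<open>i\<close>. As the first homology vanishes it is a boundary, and the coefficient at \<open>i\<close> of a boundary
  is a combination of the \<open>z j\<close> with \<open>j \<noteq> i\<close>.\<close>

theorem regular_sequence_imp_nonzerodivisor:
  assumes ys: "regular_sequence ys" "length ys = n"
    and rad: "\<And>y. y \<in> set ys \<Longrightarrow> \<exists>N. y ^ N \<in> ideal_gen (z ` {..<n})"
    and i: "i < n" and s: "z i * s \<in> ideal_gen (z ` ({..<n} - {i}))"
  shows "s \<in> ideal_gen (z ` ({..<n} - {i}))"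
proof -
  obtain c where c: "z i * s = (\<Sum>j\<in>{..<n} - {i}. z j * c j)"
    using s by (auto simp: ideal_gen_image mult.commute)
  (* Only the values on singletons enter below. *)
  define f where "f T = (if T = {i} then s else - c (the_elem T))" for T
  have "koszul_diff n z f {} = (\<Sum>j<n. z j * f {j})"
    by (simp add: koszul_diff_def koszul_sign_def)
  also have "\<dots> = z i * f {i} + (\<Sum>j\<in>{..<n} - {i}. z j * f {j})"
    using i by (simp add: sum.remove)
  also have "\<dots> = 0"
    by (simp add: f_def c sum_negf)
  finally have 0: "koszul_diff n z f {} = 0" .
  have "koszul_diff n z f T \<in> {0}" if "T \<subseteq> {..<n}" "Suc (card T) = Suc 0" for T
  proof -
    have "T = {}" using that finite_subset[of T "{..<n}"] by auto
    then show ?thesis using 0 by simp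
  qed
  moreover have "koszul_exact n z {0} (Suc 0)"
    using koszul_exact_regular_sequence[OF ys rad, of 0] by simp
  ultimately obtain g where "\<forall>T\<subseteq>{..<n}. card T = Suc 0 \<longrightarrow> f T - koszul_diff n z g T \<in> {0}"
    unfolding koszul_exact_def by metis
  then have "s = koszul_diff n z g {i}" using i by (auto simp: f_def dest: spec[of _ "{i}"])
  also have "\<dots> \<in> ideal_gen (z ` ({..<n} - {i}))"
    unfolding koszul_diff_def
  proof (intro ideal_sum)
    fix j assume "j \<in> {..<n} - {i}"
    then have "(koszul_sign j {i} * g (insert j {i})) * z j \<in> ideal_gen (z ` ({..<n} - {i}))"
      by (intro ideal_mult ideal_gen_base) auto
    then show "koszul_sign j {i} * z j * g (insert j {i}) \<in> ideal_gen (z ` ({..<n} - {i}))"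
      by (simp add: ac_simps)
  qed simp
  finally show ?thesis .
qed

section \<open>Primes and their homogeneous parts\<close>

lemma prime_ideal_1: "prime_ideal P \<Longrightarrow> 1 \<notin> P"
  using ideal_eq_UNIV_iff by (auto simp: prime_ideal_def)

lemma prime_ideal_mult_iff: "prime_ideal P \<Longrightarrow> a * b \<in> P \<longleftrightarrow> a \<in> P \<or> b \<in> P"
  unfolding prime_ideal_def using ideal_mult[of P] mult.commute[of a b] by metis

context graded_ring
begin

text \<open>For an ideal \<open>P\<close> this is the largest homogeneous ideal contained in \<open>P\<close>, usually
  written \<open>P\<^sup>*\<close>.\<close>

definition hpart :: "'a set \<Rightarrow> 'a set" where
  "hpart P = {s. \<forall>i. hcomp s i \<in> P}"

lemma hpart_mono: "P \<subseteq> Q \<Longrightarrow> hpart P \<subseteq> hpart Q"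
  by (auto simp: hpart_def)

lemma hpart_subset:
  assumes "ideal P"
  shows "hpart P \<subseteq> P"
proof
  fix s assume "s \<in> hpart P"
  then have "(\<Sum>i | hcomp s i \<noteq> 0. hcomp s i) \<in> P"
    by (intro ideal_sum[OF assms]) (simp add: hpart_def)
  then show "s \<in> P" using sum_hcomp[of s] by simp
qed

lemma homogeneous_in_hpart:
  assumes "ideal P" "a \<in> gr i"
  shows "a \<in> hpart P \<longleftrightarrow> a \<in> P"
  using assms hpart_subset[of P] by (auto simp: hpart_def hcomp_homogeneous ideal_0)

lemma ideal_hpart:
  assumes "ideal P"
  shows "ideal (hpart P)"
proof (rule regular_module.subspaceI)
  fix c s assume "s \<in> hpart P"
  then show "c * s \<in> hpart P"
    using assms
    by (auto simp: hpart_def hcomp_mult[OF order_refl finite_hcomp]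
        intro!: ideal_sum ideal_mult ideal_0)
qed (use assms in \<open>auto simp: hpart_def hcomp_add ideal_add ideal_0\<close>)

text \<open>Modulo \<open>P\<close> only one summand of the component of the product survives. Applied to the
  highest, or lowest, surviving components of two factors, it shows that these multiply as the
  leading, or trailing, terms of polynomials over a domain.\<close>

lemma hcomp_mult_notin:
  assumes P: "prime_ideal P" and i: "hcomp a i \<notin> P" and j: "hcomp b j \<notin> P"
    and others: "\<And>k. k \<noteq> i \<Longrightarrow> k \<le> i + j \<Longrightarrow> hcomp a k \<in> P \<or> hcomp b (i + j - k) \<in> P"
  shows "hcomp (a * b) (i + j) \<notin> P"
proof
  assume in_P: "hcomp (a * b) (i + j) \<in> P"
  have idl: "ideal P" using P by (simp add: prime_ideal_def)
  let ?I = "{k. hcomp a k \<noteq> 0}"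
  let ?t = "\<lambda>k. if k \<le> i + j then hcomp a k * hcomp b (i + j - k) else 0"
  have "i \<in> ?I" using i ideal_0[OF idl] by auto
  then have "hcomp (a * b) (i + j) = ?t i + (\<Sum>k\<in>?I - {i}. ?t k)"
    unfolding hcomp_mult[OF order_refl finite_hcomp] by (intro sum.remove finite_hcomp)
  moreover have "?t k \<in> P" if "k \<noteq> i" for k
    using others[OF that] by (auto simp: prime_ideal_mult_iff[OF P] ideal_0[OF idl])
  then have "(\<Sum>k\<in>?I - {i}. ?t k) \<in> P" by (intro ideal_sum[OF idl]) auto
  ultimately have "?t i \<in> P" using in_P ideal_diff[OF idl] by fastforce
  then show False using i j by (simp add: prime_ideal_mult_iff[OF P])
qed

text \<open>The degrees in which \<open>s\<close> survives modulo \<open>hpart P\<close>.\<close>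

definition support :: "'a set \<Rightarrow> 'a \<Rightarrow> nat set" where
  "support P s = {i. hcomp s i \<notin> P}"

text \<open>The length of the degree range of \<open>s\<close> modulo \<open>hpart P\<close>. It plays the role of the degree
  of a Laurent polynomial: multiplication by a homogeneous element outside \<open>P\<close> does not change it.\<close>

definition width :: "'a set \<Rightarrow> 'a \<Rightarrow> nat" where
  "width P s = Max (support P s) - Min (support P s)"

lemma finite_support:
  assumes "ideal P"
  shows "finite (support P s)"
  by (rule finite_subset[OF _ finite_hcomp[of s]]) (use ideal_0[OF assms] in \<open>auto simp: support_def\<close>)

lemma support_empty_iff: "support P s = {} \<longleftrightarrow> s \<in> hpart P"
  by (auto simp: support_def hpart_def)

lemma support_cong:
  assumes "ideal P" "s - t \<in> hpart P"
  shows "support P s = support P t"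
proof -
  have "hcomp s i - hcomp t i \<in> P" for i
    using assms(2) by (auto simp: hpart_def hcomp_diff)
  then have "hcomp s i \<in> P \<longleftrightarrow> hcomp t i \<in> P" for i
    using ideal_add[OF assms(1)] ideal_diff[OF assms(1)]
    by (metis add_diff_cancel_left' add.commute diff_add_cancel)
  then show ?thesis by (simp add: support_def)
qed

lemma width_le:
  assumes "ideal P" "s \<notin> hpart P" "support P s \<subseteq> {l..u}"
  shows "width P s \<le> u - l"
proof -
  have *: "finite (support P s)" "support P s \<noteq> {}"
    using assms finite_support support_empty_iff by auto
  then have "Max (support P s) \<le> u" "l \<le> Min (support P s)"
    using assms(3) by auto
  then show ?thesis unfolding width_def by linarith
qed

lemma width_mult:
  assumes P: "prime_ideal P" and s: "s \<notin> hpart P" and t: "t \<notin> hpart P"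
  shows "width P s + width P t \<le> width P (s * t)"
    and mult_notin_hpart: "s * t \<notin> hpart P"
proof -
  have idl: "ideal P" using P by (simp add: prime_ideal_def)
  have fin: "finite (support P r)" for r by (rule finite_support[OF idl])
  have ne: "support P s \<noteq> {}" "support P t \<noteq> {}" using s t support_empty_iff by auto
  let ?a = "Min (support P s)" and ?b = "Max (support P s)"
  let ?c = "Min (support P t)" and ?e = "Max (support P t)"
  have mem: "?a \<in> support P s" "?b \<in> support P s" "?c \<in> support P t" "?e \<in> support P t"
    using fin ne by auto
  have out: "hcomp r k \<in> P" if "k < Min (support P r) \<or> Max (support P r) < k" for r k
  proof -
    have "k \<notin> support P r" using fin[of r] that Max_ge[of "support P r" k] Min_le[of "support P r" k] by linarith
    then show ?thesis by (simp add: support_def)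
  qed
  have "hcomp (s * t) (?b + ?e) \<notin> P"
  proof (rule hcomp_mult_notin[OF P])
    fix k assume "k \<noteq> ?b" "k \<le> ?b + ?e"
    then have "?b < k \<or> ?e < ?b + ?e - k" by linarith
    then show "hcomp s k \<in> P \<or> hcomp t (?b + ?e - k) \<in> P" using out by blast
  qed (use mem in \<open>auto simp: support_def\<close>)
  then have top: "?b + ?e \<in> support P (s * t)" by (simp add: support_def)
  have "hcomp (s * t) (?a + ?c) \<notin> P"
  proof (rule hcomp_mult_notin[OF P])
    fix k assume "k \<noteq> ?a" "k \<le> ?a + ?c"
    then have "k < ?a \<or> ?a + ?c - k < ?c" by linarith
    then show "hcomp s k \<in> P \<or> hcomp t (?a + ?c - k) \<in> P" using out by blast
  qed (use mem in \<open>auto simp: support_def\<close>)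
  then have bot: "?a + ?c \<in> support P (s * t)" by (simp add: support_def)
  show "s * t \<notin> hpart P" using top support_empty_iff by auto
  have "?b + ?e \<le> Max (support P (s * t))" "Min (support P (s * t)) \<le> ?a + ?c"
    using fin top bot by auto
  moreover have "?a \<le> ?b" "?c \<le> ?e" using fin mem by auto
  ultimately show "width P s + width P t \<le> width P (s * t)"
    unfolding width_def by linarith
qed

lemma width_homogeneous_mult:
  assumes P: "prime_ideal P" and h: "h \<in> gr j" "h \<notin> P" and s: "s \<notin> hpart P"
  shows "width P (h * s) \<le> width P s"
proof -
  have idl: "ideal P" using P by (simp add: prime_ideal_def)
  have h': "h \<notin> hpart P" using homogeneous_in_hpart[OF idl h(1)] h(2) by simp
  have fin: "finite (support P s)" by (rule finite_support[OF idl])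
  have "support P (h * s) \<subseteq> {j + Min (support P s)..j + Max (support P s)}"
  proof
    fix k assume "k \<in> support P (h * s)"
    then have k: "hcomp (h * s) k \<notin> P" by (simp add: support_def)
    then have "j \<le> k" using ideal_0[OF idl] by (auto simp: hcomp_mult_homogeneous[OF h(1)] split: if_splits)
    with k have "k - j \<in> support P s"
      by (simp add: hcomp_mult_homogeneous[OF h(1)] support_def prime_ideal_mult_iff[OF P])
    then have "Min (support P s) \<le> k - j" "k - j \<le> Max (support P s)"
      using fin by auto
    then show "k \<in> {j + Min (support P s)..j + Max (support P s)}" using \<open>j \<le> k\<close> by auto
  qed
  from width_le[OF idl mult_notin_hpart[OF P h' s] this]
  show ?thesis by (simp add: width_def)
qed

lemma prime_ideal_hpart:
  assumes "prime_ideal P"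
  shows "prime_ideal (hpart P)"
  unfolding prime_ideal_def
proof (intro conjI allI impI)
  have idl: "ideal P" using assms by (simp add: prime_ideal_def)
  then show "ideal (hpart P)" by (rule ideal_hpart)
  show "hpart P \<noteq> UNIV" using hpart_subset[OF idl] prime_ideal_1[OF assms] by auto
qed (use mult_notin_hpart[OF assms] in blast)

text \<open>Localising the ring modulo \<open>hpart P\<close> at its nonzero homogeneous elements gives a field or a
  ring of Laurent polynomials over a field, where \<open>P\<close> is principal, generated by an element of least
  width. Clearing denominators gives the present statement, which is proved directly by division
  with remainder: subtracting a multiple of \<open>f\<close> cancels the top component of a homogeneous
  multiple of \<open>g\<close>.\<close>

lemma pseudo_division:
  assumes P: "prime_ideal P" and f: "f \<in> P" "f \<notin> hpart P"
    and min: "\<And>g. g \<in> P \<Longrightarrow> g \<notin> hpart P \<Longrightarrow> width P f \<le> width P g"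
    and g: "g \<in> P"
  shows "\<exists>h j q. h \<in> gr j \<and> h \<notin> P \<and> h * g - q * f \<in> hpart P"
  using g
proof (induction "width P g" arbitrary: g rule: less_induct)
  case less
  have idl: "ideal P" using P by (simp add: prime_ideal_def)
  show ?case
  proof (cases "g \<in> hpart P")
    case True
    then have "1 * g - 0 * f \<in> hpart P" by simp
    then show ?thesis using one_in_gr prime_ideal_1[OF P] by blast
  next
    case False
    have fin: "finite (support P r)" for r by (rule finite_support[OF idl])
    let ?a = "Min (support P f)" and ?b = "Max (support P f)"
    let ?c = "Min (support P g)" and ?e = "Max (support P g)"
    have "support P f \<noteq> {}" "support P g \<noteq> {}" using f False support_empty_iff by auto
    then have mem: "?a \<in> support P f" "?b \<in> support P f" "?c \<in> support P g" "?e \<in> support P g"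
      using fin by auto
    have le: "?a \<le> ?b" "?c \<le> ?e" using fin mem by auto
    have w: "?b - ?a \<le> ?e - ?c" using min[OF less.prems False] by (simp add: width_def)
    define fb where "fb = hcomp f ?b"
    define ge where "ge = hcomp g ?e"
    have fb: "fb \<in> gr ?b" "fb \<notin> P" and ge: "ge \<in> gr ?e"
      using mem by (auto simp: fb_def ge_def hcomp_in_gr support_def)
    define g' where "g' = fb * g - ge * f"
    have g': "g' \<in> P" unfolding g'_def using idl f less.prems by (intro ideal_diff ideal_mult)
    have supp: "?b + ?c \<le> k \<and> k < ?b + ?e" if "k \<in> support P g'" for k
    proof -
      have comp: "hcomp g' k = (if ?b \<le> k then fb * hcomp g (k - ?b) else 0)
          - (if ?e \<le> k then ge * hcomp f (k - ?e) else 0)"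
        unfolding g'_def hcomp_diff hcomp_mult_homogeneous[OF fb(1)] hcomp_mult_homogeneous[OF ge] ..
      have notin: "hcomp g' k \<notin> P" using that by (simp add: support_def)
      have ne: "k \<noteq> ?b + ?e"
        using notin comp ideal_0[OF idl] by (auto simp: fb_def ge_def mult.commute)
      have "?b \<le> k \<and> k - ?b \<in> support P g \<or> ?e \<le> k \<and> k - ?e \<in> support P f"
      proof (rule ccontr)
        assume "\<not> ?thesis"
        then have "(if ?b \<le> k then fb * hcomp g (k - ?b) else 0) \<in> P"
          "(if ?e \<le> k then ge * hcomp f (k - ?e) else 0) \<in> P"
          using idl by (auto simp: support_def ideal_mult ideal_0)
        then show False using notin ideal_diff[OF idl] unfolding comp by blast
      qed
      then show ?thesis
      proof
        assume k: "?b \<le> k \<and> k - ?b \<in> support P g"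
        then have "?c \<le> k - ?b" "k - ?b \<le> ?e" using fin by auto
        then show ?thesis using k ne by linarith
      next
        assume k: "?e \<le> k \<and> k - ?e \<in> support P f"
        then have "?a \<le> k - ?e" "k - ?e \<le> ?b" using fin by auto
        then show ?thesis using k ne w le by linarith
      qed
    qed
    have "\<exists>h j q. h \<in> gr j \<and> h \<notin> P \<and> h * g' - q * f \<in> hpart P"
    proof (cases "g' \<in> hpart P")
      case True
      then have "1 * g' - 0 * f \<in> hpart P" by simp
      then show ?thesis using one_in_gr prime_ideal_1[OF P] by blast
    next
      case False
      then obtain k where "k \<in> support P g'" using support_empty_iff by blast
      from supp[OF this] have pos: "?c < ?e" by linarith
      have "support P g' \<subseteq> {?b + ?c..?b + ?e - 1}" using supp by fastforce
      from width_le[OF idl False this] have "width P g' < width P g"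
        using pos unfolding width_def by linarith
      then show ?thesis using less.hyps g' by blast
    qed
    then obtain h j q where h: "h \<in> gr j" "h \<notin> P" "h * g' - q * f \<in> hpart P" by blast
    have "(h * fb) * g - (q + h * ge) * f = h * g' - q * f"
      by (simp add: g'_def algebra_simps)
    moreover have "h * fb \<in> gr (j + ?b)" "h * fb \<notin> P"
      using h fb gr_mult prime_ideal_mult_iff[OF P] by auto
    ultimately show ?thesis using h(3) by metis
  qed
qed

text \<open>After localisation at the homogeneous elements this says that Laurent polynomials over a
  field have dimension at most one. With \<open>f\<close> a generator of \<open>P\<close> in that sense and \<open>g\<close> of least width
  in \<open>Q\<close>, the quotient of \<open>g\<close> by \<open>f\<close> would be a narrower element of \<open>Q\<close>, the width of \<open>f\<close>
  being positive because homogeneous elements of \<open>P\<close> lie in \<open>hpart P\<close>.\<close>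

lemma no_prime_strictly_between:
  assumes P: "prime_ideal P" and Q: "prime_ideal Q" and sub: "hpart P \<subseteq> Q" "Q \<subset> P"
  shows "Q = hpart P"
proof (rule ccontr)
  assume "Q \<noteq> hpart P"
  then obtain g0 where "g0 \<in> Q \<and> g0 \<notin> hpart P" using sub(1) by auto
  from ex_has_least_nat[of "\<lambda>s. s \<in> Q \<and> s \<notin> hpart P", OF this, of "width P"]
  obtain g where g: "g \<in> Q" "g \<notin> hpart P"
    and g_min: "\<And>s. s \<in> Q \<Longrightarrow> s \<notin> hpart P \<Longrightarrow> width P g \<le> width P s" by auto
  obtain f0 where "f0 \<in> P \<and> f0 \<notin> hpart P" using sub by blast
  from ex_has_least_nat[of "\<lambda>s. s \<in> P \<and> s \<notin> hpart P", OF this, of "width P"]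
  obtain f where f: "f \<in> P" "f \<notin> hpart P"
    and f_min: "\<And>s. s \<in> P \<Longrightarrow> s \<notin> hpart P \<Longrightarrow> width P f \<le> width P s" by auto
  have idlP: "ideal P" and idlQ: "ideal Q" using P Q by (simp_all add: prime_ideal_def)
  have division: "\<exists>h j q. h \<in> gr j \<and> h \<notin> P \<and> h * s - q * f \<in> hpart P" if "s \<in> P" for s
    using pseudo_division[OF P f _ that] f_min by blast
  have "f \<notin> Q"
  proof
    assume "f \<in> Q"
    have "s \<in> Q" if s: "s \<in> P" for s
    proof -
      obtain h j q where h: "h \<in> gr j" "h \<notin> P" "h * s - q * f \<in> hpart P"
        using division[OF s] by blast
      have "(h * s - q * f) + q * f \<in> Q"
        using h(3) sub(1) \<open>f \<in> Q\<close> by (intro ideal_add ideal_mult idlQ) auto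
      then have "h * s \<in> Q" by simp
      then show ?thesis using h(2) sub(2) prime_ideal_mult_iff[OF Q] by blast
    qed
    then show False using sub(2) by blast
  qed
  obtain h j q where h: "h \<in> gr j" "h \<notin> P" and hg: "h * g - q * f \<in> hpart P"
    using division[of g] g(1) sub(2) by blast
  have h': "h \<notin> hpart P" using homogeneous_in_hpart[OF idlP h(1)] h(2) by simp
  have "h * g - (h * g - q * f) \<in> Q"
    by (rule ideal_diff[OF idlQ ideal_mult[OF idlQ g(1)]]) (use hg sub(1) in blast)
  then have q: "q \<in> Q" using \<open>f \<notin> Q\<close> prime_ideal_mult_iff[OF Q] by simp
  have supp: "support P (h * g) = support P (q * f)" by (rule support_cong[OF idlP hg])
  have "q \<notin> hpart P"
  proof
    assume "q \<in> hpart P"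
    then have "q * f \<in> hpart P" using ideal_mult[OF ideal_hpart[OF idlP]] mult.commute by metis
    then show False using supp support_empty_iff mult_notin_hpart[OF P h' g(2)] by blast
  qed
  then have "width P g + width P f \<le> width P q + width P f" using g_min q by simp
  also have "\<dots> \<le> width P (q * f)" by (rule width_mult[OF P \<open>q \<notin> hpart P\<close> f(2)])
  also have "\<dots> = width P (h * g)" by (simp add: width_def supp)
  also have "\<dots> \<le> width P g" by (rule width_homogeneous_mult[OF P h g(2)])
  finally have 0: "width P f = 0" by simp
  have "support P f \<noteq> {}" using f support_empty_iff by auto
  then obtain a where a: "a \<in> support P f" by blast
  have "i = a" if "i \<in> support P f" for i
  proof -
    have "Min (support P f) \<le> i" "i \<le> Max (support P f)" "Min (support P f) \<le> a" "a \<le> Max (support P f)"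
      using that a finite_support[OF idlP] by auto
    then show ?thesis using 0 unfolding width_def by linarith
  qed
  then have "f - hcomp f a \<in> hpart P"
    using ideal_0[OF idlP]
    by (auto simp: hpart_def hcomp_diff hcomp_homogeneous[OF hcomp_in_gr] support_def)
  then have "f - hcomp f a \<in> P" using hpart_subset[OF idlP] by blast
  then have "f - (f - hcomp f a) \<in> P" by (rule ideal_diff[OF idlP f(1)])
  then show False using a by (simp add: support_def)
qed

end

definition chain_to :: "nat \<Rightarrow> 'a::comm_ring_1 set \<Rightarrow> bool" where
  "chain_to l P \<longleftrightarrow> (\<exists>Q. prime_chain l Q \<and> Q l = P)"

lemma chain_to_prime: "chain_to l P \<Longrightarrow> prime_ideal P"
  by (auto simp: chain_to_def prime_chain_def)

lemma chain_to_0: "prime_ideal P \<Longrightarrow> chain_to 0 P"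
  unfolding chain_to_def prime_chain_def by (rule exI[of _ "\<lambda>_. P"]) simp

lemma chain_to_Suc: "chain_to (Suc l) P \<longleftrightarrow> prime_ideal P \<and> (\<exists>Q. chain_to l Q \<and> Q \<subset> P)"
proof
  assume "chain_to (Suc l) P"
  then obtain Q where Q: "prime_chain (Suc l) Q" "Q (Suc l) = P" by (auto simp: chain_to_def)
  then have "prime_chain l Q" "Q l \<subset> P" "prime_ideal P"
    unfolding prime_chain_def by (metis le_SucI less_SucI, blast, blast)
  then have "chain_to l (Q l)" "Q l \<subset> P" "prime_ideal P" by (auto simp: chain_to_def)
  then show "prime_ideal P \<and> (\<exists>Q. chain_to l Q \<and> Q \<subset> P)" by blast
next
  assume "prime_ideal P \<and> (\<exists>Q. chain_to l Q \<and> Q \<subset> P)"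
  then obtain Q where "prime_ideal P" "prime_chain l Q" "Q l \<subset> P" by (auto simp: chain_to_def)
  then have "prime_chain (Suc l) (Q(Suc l := P))"
    by (auto simp: prime_chain_def less_Suc_eq le_Suc_eq)
  then show "chain_to (Suc l) P" unfolding chain_to_def by (intro exI[of _ "Q(Suc l := P)"]) simp
qed

context graded_ring
begin

text \<open>The height drops by at most one on passing from \<open>P\<close> to \<open>hpart P\<close>. Let \<open>Q\<close> be the
  last prime of the chain below \<open>P\<close>. If \<open>hpart Q\<close> is smaller than \<open>hpart P\<close>, a chain for \<open>hpart Q\<close> can
  be prolonged; otherwise \<open>Q\<close> lies between \<open>hpart P\<close> and \<open>P\<close> and hence equals \<open>hpart P\<close>.\<close>

lemma chain_to_hpart:
  assumes "chain_to (Suc l) P"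
  shows "chain_to l (hpart P)"
  using assms
proof (induction l arbitrary: P)
  case 0
  then show ?case by (intro chain_to_0 prime_ideal_hpart chain_to_prime)
next
  case (Suc l)
  then obtain Q where Q: "chain_to (Suc l) Q" "Q \<subset> P" by (metis chain_to_Suc)
  have P: "prime_ideal P" using Suc.prems by (rule chain_to_prime)
  have le: "hpart Q \<subseteq> hpart P" using Q by (intro hpart_mono) auto
  show ?case
  proof (cases "hpart Q = hpart P")
    case True
    have "ideal Q" using chain_to_prime[OF Q(1)] by (simp add: prime_ideal_def)
    then have "Q = hpart P"
      using no_prime_strictly_between[OF P chain_to_prime[OF Q(1)]] Q(2) hpart_subset True by metis
    then show ?thesis using Q(1) by simp
  next
    case False
    then show ?thesis
      using Suc.IH[OF Q(1)] le prime_ideal_hpart[OF P] chain_to_Suc[of l "hpart P"] by blast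
  qed
qed

lemma irrelevant_ideal_iff: "s \<in> irrelevant_ideal gr \<longleftrightarrow> hcomp s 0 = 0"
proof
  assume "s \<in> irrelevant_ideal gr"
  then show "hcomp s 0 = 0"
    unfolding irrelevant_ideal_def
  proof (induction rule: regular_module.span_induct_alt)
    case (step c a s)
    then obtain j where "0 < j" "a \<in> gr j" by auto
    then show ?case
      using step hcomp_mult_homogeneous[of a j c 0] by (simp add: hcomp_add mult.commute)
  qed simp
next
  assume 0: "hcomp s 0 = 0"
  have "(\<Sum>i | hcomp s i \<noteq> 0. hcomp s i) \<in> irrelevant_ideal gr"
    unfolding irrelevant_ideal_def
  proof (intro ideal_sum ideal_gen_base)
    fix i assume "i \<in> {i. hcomp s i \<noteq> 0}"
    then have "0 < i" using 0 by (cases i) auto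
    then show "hcomp s i \<in> \<Union> (gr ` {0<..})" using hcomp_in_gr by blast
  qed simp
  then show "s \<in> irrelevant_ideal gr" using sum_hcomp[of s] by simp
qed

lemma ideal_irrelevant: "ideal (irrelevant_ideal gr)"
  by (simp add: irrelevant_ideal_def)

lemma hcomp_0_mult: "hcomp (s * t) 0 = hcomp s 0 * hcomp t 0"
proof -
  have "hcomp (s * t) 0
      = (\<Sum>i\<in>insert 0 {i. hcomp s i \<noteq> 0}. if i \<le> 0 then hcomp s i * hcomp t (0 - i) else 0)"
    by (rule hcomp_mult) (auto intro: finite_hcomp)
  also have "\<dots> = (\<Sum>i\<in>insert 0 {i. hcomp s i \<noteq> 0}. if i = 0 then hcomp s 0 * hcomp t 0 else 0)"
    by (intro sum.cong) auto
  also have "\<dots> = hcomp s 0 * hcomp t 0"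
    by (subst sum.delta) (auto intro: finite_hcomp)
  finally show ?thesis .
qed

context
  assumes field: "is_subfield (gr 0)"
begin

lemma degree_0_unit:
  assumes "a \<in> gr 0" "a \<noteq> 0"
  obtains b where "b * a = 1"
proof -
  obtain b where "a * b = 1" using field assms by (auto simp: is_subfield_def)
  then show thesis using that[of b] by (simp add: mult.commute)
qed

lemma prime_irrelevant: "prime_ideal (irrelevant_ideal gr)"
  unfolding prime_ideal_def
proof (intro conjI allI impI)
  show "ideal (irrelevant_ideal gr)" by (rule ideal_irrelevant)
  have "1 \<notin> irrelevant_ideal gr"
    using field by (simp add: irrelevant_ideal_iff hcomp_homogeneous[OF one_in_gr] is_subfield_def)
  then show "irrelevant_ideal gr \<noteq> UNIV" by blast
  fix a b assume "a * b \<in> irrelevant_ideal gr"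
  then have ab: "hcomp a 0 * hcomp b 0 = 0" by (simp add: irrelevant_ideal_iff hcomp_0_mult)
  show "a \<in> irrelevant_ideal gr \<or> b \<in> irrelevant_ideal gr"
  proof (cases "hcomp a 0 = 0")
    case False
    then obtain u where "u * hcomp a 0 = 1" using degree_0_unit[OF hcomp_in_gr] by blast
    then have "hcomp b 0 = u * (hcomp a 0 * hcomp b 0)" by (simp flip: mult.assoc)
    then show ?thesis using ab by (simp add: irrelevant_ideal_iff)
  qed (simp add: irrelevant_ideal_iff)
qed

lemma maximal_irrelevant: "maximal_ideal (irrelevant_ideal gr)"
  unfolding maximal_ideal_def
proof (intro conjI allI impI)
  show "ideal (irrelevant_ideal gr)" "irrelevant_ideal gr \<noteq> UNIV"
    using prime_irrelevant by (auto simp: prime_ideal_def)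
  fix I assume I: "ideal I \<and> irrelevant_ideal gr \<subseteq> I"
  show "I = irrelevant_ideal gr \<or> I = UNIV"
  proof (rule ccontr)
    assume *: "\<not> (I = irrelevant_ideal gr \<or> I = UNIV)"
    then obtain s where s: "s \<in> I" "s \<notin> irrelevant_ideal gr" using I by auto
    then obtain b where b: "b * hcomp s 0 = 1"
      using degree_0_unit[OF hcomp_in_gr] by (auto simp: irrelevant_ideal_iff)
    have "s - hcomp s 0 \<in> irrelevant_ideal gr"
      by (simp add: irrelevant_ideal_iff hcomp_diff hcomp_homogeneous[OF hcomp_in_gr])
    with I have "s - hcomp s 0 \<in> I" by blast
    with I s(1) have "s - (s - hcomp s 0) \<in> I"
      using ideal_diff[of I s "s - hcomp s 0"] by blast
    then have "b * hcomp s 0 \<in> I" using I ideal_mult by auto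
    then show False using * I b ideal_eq_UNIV_iff by auto
  qed
qed

lemma hpart_subset_irrelevant:
  assumes "prime_ideal P"
  shows "hpart P \<subseteq> irrelevant_ideal gr"
proof
  fix s assume s: "s \<in> hpart P"
  show "s \<in> irrelevant_ideal gr"
  proof (rule ccontr)
    assume "s \<notin> irrelevant_ideal gr"
    then obtain b where b: "b * hcomp s 0 = 1"
      using degree_0_unit[OF hcomp_in_gr] by (auto simp: irrelevant_ideal_iff)
    have "b * hcomp s 0 \<in> P" using s assms by (auto simp: hpart_def prime_ideal_def ideal_mult)
    then show False using b prime_ideal_1[OF assms] by simp
  qed
qed

text \<open>The homogeneous maximal ideal has the largest height of all primes: the step lost on
  passing from \<open>P\<close> to \<open>hpart P\<close> is regained by the inclusion of \<open>hpart P\<close> in the maximal ideal.\<close>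

lemma chain_to_irrelevant:
  fixes P :: "'a set"
  assumes "chain_to l P"
  shows "chain_to l (irrelevant_ideal gr)"
proof (cases l)
  case 0
  then show ?thesis using chain_to_0[OF prime_irrelevant] by simp
next
  case (Suc m)
  have P: "prime_ideal P" using assms by (rule chain_to_prime)
  have m: "chain_to m (hpart P)" using assms Suc by (simp add: chain_to_hpart)
  show ?thesis
  proof (cases "hpart P = irrelevant_ideal gr")
    case True
    then have "irrelevant_ideal gr \<subseteq> P" using P hpart_subset by (auto simp: prime_ideal_def)
    then have "P = irrelevant_ideal gr"
      using maximal_irrelevant P by (auto simp: maximal_ideal_def prime_ideal_def)
    then show ?thesis using assms by simp
  next
    case False
    then show ?thesis
      using m Suc hpart_subset_irrelevant[OF P] chain_to_Suc prime_irrelevant by blast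
  qed
qed

lemma height_irrelevant:
  assumes "krull_dim TYPE('a) = enat d"
  shows "enat d \<le> height (irrelevant_ideal gr)"
proof -
  have "\<exists>P :: 'a set. chain_to d P"
  proof (cases d)
    case 0
    then show ?thesis using chain_to_0[OF prime_irrelevant] by blast
  next
    case (Suc m)
    then have "enat m < krull_dim TYPE('a)" using assms by simp
    then obtain l and Q :: "nat \<Rightarrow> 'a set" where l: "m < l" "prime_chain l Q"
      unfolding krull_dim_def less_Sup_iff by auto
    then have "prime_chain d Q" using Suc by (auto simp: prime_chain_def)
    then show ?thesis by (auto simp: chain_to_def)
  qed
  then have "chain_to d (irrelevant_ideal gr)" using chain_to_irrelevant by blast
  then show ?thesis unfolding height_def chain_to_def by (intro Sup_upper) auto
qed

text \<open>Cohen--Macaulayness equates the depth of the homogeneous maximal ideal with its height,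
  which has just been bounded below by the Krull dimension.\<close>

lemma regular_sequence_in_irrelevant:
  assumes "cohen_macaulay TYPE('a)" "krull_dim TYPE('a) = enat d"
  obtains ys where "regular_sequence ys" "length ys = d" "set ys \<subseteq> irrelevant_ideal gr"
proof -
  have "depth (irrelevant_ideal gr) = height (irrelevant_ideal gr)"
    using assms(1) maximal_irrelevant by (simp add: cohen_macaulay_def)
  then have depth: "enat d \<le> depth (irrelevant_ideal gr)"
    using height_irrelevant[OF assms(2)] by simp
  have "\<exists>xs. set xs \<subseteq> irrelevant_ideal gr \<and> regular_sequence xs \<and> d \<le> length xs"
  proof (cases d)
    case 0
    have "(1 :: 'a) \<notin> ideal_gen {}"
      using field by (simp add: is_subfield_def)
    then have "ideal_gen {} \<noteq> (UNIV :: 'a set)" by blast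
    then have "regular_sequence ([] :: 'a list)" by (simp add: regular_sequence_def)
    then show ?thesis using 0 by (intro exI[of _ "[]"]) simp
  next
    case (Suc m)
    then have "enat m < depth (irrelevant_ideal gr)"
      using depth by (meson enat_ord_simps(2) lessI less_le_trans)
    then show ?thesis unfolding depth_def less_Sup_iff using Suc by auto
  qed
  then obtain xs where xs: "set xs \<subseteq> irrelevant_ideal gr" "regular_sequence xs" "d \<le> length xs"
    by blast
  have "ideal_gen (set (take d xs)) \<subseteq> ideal_gen (set xs)"
    by (intro ideal_gen_mono set_take_subset)
  then have "regular_sequence (take d xs)"
    using xs(2,3) by (auto simp: regular_sequence_def min_def)
  moreover have "set (take d xs) \<subseteq> irrelevant_ideal gr" using xs(1) set_take_subset by fast
  ultimately show thesis using that[of "take d xs"] xs(3) by simp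
qed

end

end

section \<open>Colon ideals of powers of parameters\<close>

text \<open>Independent exponents are allowed although only constant ones occur in local cohomology:
  the colon computations treat the generators one at a time.\<close>

definition power_ideal :: "(nat \<Rightarrow> 'a::comm_ring_1) \<Rightarrow> nat \<Rightarrow> (nat \<Rightarrow> nat) \<Rightarrow> 'a set" where
  "power_ideal x d a = ideal_gen ((\<lambda>i. x i ^ a i) ` {..<d})"

lemma ideal_power_ideal [simp]: "ideal (power_ideal x d a)"
  by (simp add: power_ideal_def)

lemma power_ideal_iff: "s \<in> power_ideal x d a \<longleftrightarrow> (\<exists>c. s = (\<Sum>i<d. c i * x i ^ a i))"
  by (simp add: power_ideal_def ideal_gen_image)

lemma power_in_power_ideal:
  assumes "i < d" "a i \<le> l"
  shows "c * x i ^ l \<in> power_ideal x d a"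
proof -
  have "x i ^ a i \<in> power_ideal x d a"
    using assms(1) unfolding power_ideal_def by (intro ideal_gen_base) auto
  then have "(c * x i ^ (l - a i)) * x i ^ a i \<in> power_ideal x d a" by (rule ideal_mult[rotated]) simp
  then show ?thesis using assms(2) by (simp add: mult.assoc flip: power_add)
qed

text \<open>The one consequence of Cohen--Macaulayness that the colon computations rest on: each
  \<open>x i\<close> is a nonzerodivisor modulo arbitrary powers of the others.\<close>

locale independent_powers =
  fixes x :: "nat \<Rightarrow> 'a::comm_ring_1" and d :: nat
  assumes cancel_generator: "i < d \<Longrightarrow>
    x i * s \<in> ideal_gen ((\<lambda>j. x j ^ a j) ` ({..<d} - {i})) \<Longrightarrow>
    s \<in> ideal_gen ((\<lambda>j. x j ^ a j) ` ({..<d} - {i}))"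
begin

lemma cancel_generator_power:
  assumes "i < d" "x i ^ l * s \<in> ideal_gen ((\<lambda>j. x j ^ a j) ` ({..<d} - {i}))"
  shows "s \<in> ideal_gen ((\<lambda>j. x j ^ a j) ` ({..<d} - {i}))"
  using assms(2)
proof (induction l)
  case (Suc l)
  then show ?case using cancel_generator[OF assms(1)] by (simp add: mult.assoc)
qed simp

lemma power_ideal_split:
  assumes "i < d"
  shows "s \<in> power_ideal x d a \<longleftrightarrow>
    (\<exists>c. s - c * x i ^ a i \<in> ideal_gen ((\<lambda>j. x j ^ a j) ` ({..<d} - {i})))"
proof -
  have "{..<d} = insert i ({..<d} - {i})" using assms by auto
  then have "power_ideal x d a = ideal_gen (insert (x i ^ a i) ((\<lambda>j. x j ^ a j) ` ({..<d} - {i})))"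
    unfolding power_ideal_def by (metis image_insert)
  then show ?thesis by (simp add: regular_module.span_insert)
qed

lemma cancel_power:
  assumes i: "i < d" and s: "x i ^ l * s \<in> power_ideal x d (a(i := a i + l))"
  shows "s \<in> power_ideal x d a"
proof -
  have *: "(\<lambda>j. x j ^ (a(i := a i + l)) j) ` ({..<d} - {i}) = (\<lambda>j. x j ^ a j) ` ({..<d} - {i})"
    by (intro image_cong) auto
  obtain c where "x i ^ l * s - c * x i ^ (a i + l) \<in> ideal_gen ((\<lambda>j. x j ^ a j) ` ({..<d} - {i}))"
    using s unfolding power_ideal_split[OF i] * by auto
  then have "x i ^ l * (s - c * x i ^ a i) \<in> ideal_gen ((\<lambda>j. x j ^ a j) ` ({..<d} - {i}))"
    by (simp add: power_add algebra_simps)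
  then show ?thesis
    using cancel_generator_power[OF i] power_ideal_split[OF i] by blast
qed

lemma cancel_prod:
  assumes "finite T" "T \<subseteq> {..<d}"
    "(\<Prod>i\<in>T. x i ^ l) * s \<in> power_ideal x d (\<lambda>i. if i \<in> T then a i + l else a i)"
  shows "s \<in> power_ideal x d a"
  using assms
proof (induction T arbitrary: s a)
  case (insert i T)
  let ?a = "a(i := a i + l)"
  have "(\<lambda>j. if j \<in> insert i T then a j + l else a j) = (\<lambda>j. if j \<in> T then ?a j + l else ?a j)"
    using insert.hyps by auto
  then have "(\<Prod>i\<in>T. x i ^ l) * (x i ^ l * s) \<in> power_ideal x d (\<lambda>j. if j \<in> T then ?a j + l else ?a j)"
    using insert.prems insert.hyps by (simp add: ac_simps)
  then have "x i ^ l * s \<in> power_ideal x d ?a"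
    using insert.IH insert.prems by blast
  then show ?case using cancel_power insert.prems by blast
qed simp

lemma prod_mult_power_ideal:
  assumes "finite T" "s \<in> power_ideal x d a"
  shows "(\<Prod>i\<in>T. x i ^ l) * s \<in> power_ideal x d (\<lambda>i. if i \<in> T then a i + l else a i)"
proof -
  obtain c where c: "s = (\<Sum>i<d. c i * x i ^ a i)" using assms(2) by (auto simp: power_ideal_iff)
  have "(\<Prod>j\<in>T. x j ^ l) * (c i * x i ^ a i) \<in> power_ideal x d (\<lambda>i. if i \<in> T then a i + l else a i)"
    if "i < d" for i
  proof (cases "i \<in> T")
    case True
    then have "(\<Prod>j\<in>T. x j ^ l) * (c i * x i ^ a i) = ((\<Prod>j\<in>T - {i}. x j ^ l) * c i) * x i ^ (a i + l)"
      using assms(1) by (simp add: prod.remove power_add ac_simps)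
    then show ?thesis using True that by (simp only:) (rule power_in_power_ideal, auto)
  next
    case False
    have "(\<Prod>j\<in>T. x j ^ l) * (c i * x i ^ a i) = ((\<Prod>j\<in>T. x j ^ l) * c i) * x i ^ a i"
      by (simp add: ac_simps)
    then show ?thesis using False that by (simp only:) (rule power_in_power_ideal, auto)
  qed
  then show ?thesis unfolding c sum_distrib_left by (intro ideal_sum) auto
qed

text \<open>An element multiplied into \<open>(x\<^sub>0\<^sup>k, \<dots>)\<close> by all \<open>x\<^sub>i\<^sup>N\<close> is, modulo this ideal, a multiple of
  the product of the \<open>x\<^sub>i\<^sup>k\<^sup>-\<^sup>N\<close>. In local cohomology this says that a class annihilated by all
  \<open>x\<^sub>i\<^sup>N\<close> is represented by a fraction with denominator \<open>(x\<^sub>0 \<cdots> x\<^sub>d\<^sub>-\<^sub>1)\<^sup>N\<close>, which bounds its degree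
  from below. The factors \<open>x\<^sub>i\<^sup>k\<^sup>-\<^sup>N\<close> are split off one index at a time.\<close>

lemma colon_power_ideal:
  assumes N: "N \<le> k" and s: "\<And>i. i < d \<Longrightarrow> x i ^ N * s \<in> power_ideal x d (\<lambda>_. k)"
  shows "\<exists>t. s - t * (\<Prod>i<d. x i ^ (k - N)) \<in> power_ideal x d (\<lambda>_. k)"
proof -
  define M where "M = k - N"
  have "\<exists>t. s - t * (\<Prod>i\<in>T. x i ^ M) \<in> power_ideal x d (\<lambda>_. k)"
    if "finite T" "T \<subseteq> {..<d}" for T
    using that
  proof (induction T)
    case empty
    then show ?case by (intro exI[of _ s]) (simp add: ideal_0)
  next
    case (insert i T)
    then obtain t where t: "s - t * (\<Prod>i\<in>T. x i ^ M) \<in> power_ideal x d (\<lambda>_. k)" by auto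
    have i: "i < d" using insert.prems by simp
    define a where "a j = (if j \<in> T then N else k)" for j
    have a: "(\<lambda>j. if j \<in> T then a j + M else a j) = (\<lambda>_. k)"
      using N by (auto simp: a_def M_def)
    have "x i ^ N * s - x i ^ N * (s - t * (\<Prod>i\<in>T. x i ^ M)) \<in> power_ideal x d (\<lambda>_. k)"
      by (rule ideal_diff[OF ideal_power_ideal s[OF i] ideal_mult[OF ideal_power_ideal t]])
    then have "(\<Prod>i\<in>T. x i ^ M) * (x i ^ N * t) \<in> power_ideal x d (\<lambda>_. k)"
      by (simp add: algebra_simps)
    then have "x i ^ N * t \<in> power_ideal x d a"
      using cancel_prod[of T M _ a] insert by (simp add: a)
    then obtain c where c: "x i ^ N * t - c * x i ^ a i \<in> ideal_gen ((\<lambda>j. x j ^ a j) ` ({..<d} - {i}))"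
      using power_ideal_split[OF i] by blast
    have "a i = N + M" using insert.hyps N by (simp add: a_def M_def)
    then have "x i ^ N * (t - c * x i ^ M) \<in> ideal_gen ((\<lambda>j. x j ^ a j) ` ({..<d} - {i}))"
      using c by (simp add: power_add algebra_simps)
    from cancel_generator_power[OF i this]
    have "t - c * x i ^ M \<in> power_ideal x d a"
      unfolding power_ideal_def by (rule rev_subsetD[OF _ ideal_gen_mono]) auto
    from prod_mult_power_ideal[OF insert.hyps(1) this, of M]
    have "(s - t * (\<Prod>i\<in>T. x i ^ M)) + (\<Prod>i\<in>T. x i ^ M) * (t - c * x i ^ M) \<in> power_ideal x d (\<lambda>_. k)"
      unfolding a by (rule ideal_add[OF ideal_power_ideal t])
    also have "(s - t * (\<Prod>i\<in>T. x i ^ M)) + (\<Prod>i\<in>T. x i ^ M) * (t - c * x i ^ M)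
        = s - c * (\<Prod>i\<in>insert i T. x i ^ M)"
      using insert.hyps by (simp add: algebra_simps)
    finally show ?case by blast
  qed
  from this[of "{..<d}"] show ?thesis by (simp add: M_def)
qed

end

text \<open>Replacing the \<open>x j\<close> by powers, for \<open>j \<noteq> i\<close>, does not shrink the radical, so the Koszul
  argument applies to any choice of exponents.\<close>

lemma independent_powers_of_regular_sequence:
  assumes ys: "regular_sequence ys" "length ys = d"
    and rad: "\<And>y. y \<in> set ys \<Longrightarrow> \<exists>m. y ^ m \<in> ideal_gen (x ` {..<d})"
  shows "independent_powers x d"
proof
  fix i s a
  assume i: "i < d" and s: "x i * s \<in> ideal_gen ((\<lambda>j. x j ^ a j) ` ({..<d} - {i}))"
  define z where "z j = (if j = i then x i else x j ^ a j)" for j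
  have z: "z ` ({..<d} - {i}) = (\<lambda>j. x j ^ a j) ` ({..<d} - {i})"
    by (intro image_cong) (auto simp: z_def)
  have rad_z: "ideal_gen (x ` {..<d}) \<subseteq> {s. \<exists>m. s ^ m \<in> ideal_gen (z ` {..<d})}"
  proof (intro ideal_gen_minimal ideal_radical ideal_ideal_gen, safe)
    fix j assume j: "j < d"
    have "z j \<in> ideal_gen (z ` {..<d})" using j by (intro ideal_gen_base) auto
    then have "x j ^ (if j = i then 1 else a j) \<in> ideal_gen (z ` {..<d})" by (simp add: z_def split: if_splits)
    then show "\<exists>m. x j ^ m \<in> ideal_gen (z ` {..<d})" ..
  qed
  have "\<exists>m. y ^ m \<in> ideal_gen (z ` {..<d})" if y: "y \<in> set ys" for y
  proof -
    obtain m where "y ^ m \<in> ideal_gen (x ` {..<d})" using rad[OF y] by blast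
    then obtain l where "(y ^ m) ^ l \<in> ideal_gen (z ` {..<d})" using rad_z by blast
    then show ?thesis unfolding power_mult[symmetric] by blast
  qed
  moreover have "z i * s \<in> ideal_gen (z ` ({..<d} - {i}))" using s unfolding z by (simp add: z_def)
  ultimately show "s \<in> ideal_gen ((\<lambda>j. x j ^ a j) ` ({..<d} - {i}))"
    using regular_sequence_imp_nonzerodivisor[OF ys, of z i s] i unfolding z by blast
qed

section \<open>Prime characteristic\<close>

lemma CHAR_fract: "CHAR('a::idom fract) = CHAR('a)"
proof (rule CHAR_eqI)
  have of_nat: "of_nat n = to_fract (of_nat n :: 'a)" for n
    by (simp add: to_fract_def of_nat_fract)
  show "of_nat CHAR('a) = (0 :: 'a fract)" by (simp add: of_nat)
  show "CHAR('a) dvd n" if "of_nat n = (0 :: 'a fract)" for n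
    using that by (simp add: of_nat of_nat_eq_0_iff_char_dvd)
qed

lemma frobenius_power_power_ideal:
  fixes x :: "nat \<Rightarrow> 'a::idom"
  assumes "CHAR('a) > 0"
  shows "frobenius_power (power_ideal x d (\<lambda>_. k)) (CHAR('a) ^ e) = power_ideal x d (\<lambda>_. k * CHAR('a) ^ e)"
proof
  let ?q = "CHAR('a) ^ e"
  have p: "prime CHAR('a)" using assms by (rule prime_CHAR_semidom)
  show "frobenius_power (power_ideal x d (\<lambda>_. k)) ?q \<subseteq> power_ideal x d (\<lambda>_. k * ?q)"
    unfolding frobenius_power_def
  proof (intro ideal_gen_minimal ideal_power_ideal image_subsetI)
    fix s assume "s \<in> power_ideal x d (\<lambda>_. k)"
    then obtain c where "s = (\<Sum>i<d. c i * x i ^ k)" by (auto simp: power_ideal_iff)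
    then have "s ^ ?q = (\<Sum>i<d. (c i * x i ^ k) ^ ?q)"
      using freshmans_dream_sum'[OF p refl] by simp
    then have "s ^ ?q = (\<Sum>i<d. c i ^ ?q * x i ^ (k * ?q))"
      by (simp add: power_mult_distrib power_mult)
    then show "s ^ ?q \<in> power_ideal x d (\<lambda>_. k * ?q)"
      unfolding power_ideal_iff by (intro exI[of _ "\<lambda>i. c i ^ ?q"])
  qed
  show "power_ideal x d (\<lambda>_. k * ?q) \<subseteq> frobenius_power (power_ideal x d (\<lambda>_. k)) ?q"
    unfolding power_ideal_def[of x d "\<lambda>_. k * ?q"] frobenius_power_def
  proof (intro ideal_gen_mono image_subsetI)
    fix i assume "i \<in> {..<d}"
    then have "x i ^ k \<in> power_ideal x d (\<lambda>_. k)"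
      unfolding power_ideal_def by (intro ideal_gen_base) auto
    then show "x i ^ (k * ?q) \<in> (\<lambda>a. a ^ ?q) ` power_ideal x d (\<lambda>_. k)"
      by (simp add: power_mult)
  qed
qed

text \<open>The Frobenius power of a sum is the sum of the Frobenius powers, and these lie in distinct
  degrees when the summands do.\<close>

lemma hcomp_frobenius:
  fixes gr :: "nat \<Rightarrow> 'a::idom set"
  assumes "graded_ring gr" and "CHAR('a) > 0"
  shows "graded_ring.hcomp gr (s ^ (CHAR('a) ^ e)) (m * CHAR('a) ^ e) = graded_ring.hcomp gr s m ^ (CHAR('a) ^ e)"
proof -
  interpret graded_ring gr by fact
  let ?q = "CHAR('a) ^ e" and ?I = "insert m {i. hcomp s i \<noteq> 0}"
  have p: "prime CHAR('a)" using assms(2) by (rule prime_CHAR_semidom)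
  have q: "?q > 0" using assms(2) by simp
  have fin: "finite ?I" using finite_hcomp by simp
  have "s ^ ?q = (\<Sum>i\<in>?I. hcomp s i) ^ ?q"
    using fin by (subst sum_hcomp_superset) auto
  also have "\<dots> = (\<Sum>i\<in>?I. hcomp s i ^ ?q)" by (rule freshmans_dream_sum'[OF p refl])
  finally have "hcomp (s ^ ?q) (m * ?q) = (\<Sum>i\<in>?I. hcomp (hcomp s i ^ ?q) (m * ?q))"
    by (simp add: hcomp_sum)
  also have "\<dots> = (\<Sum>i\<in>?I. if i = m then hcomp s m ^ ?q else 0)"
  proof (rule sum.cong)
    fix i
    show "hcomp (hcomp s i ^ ?q) (m * ?q) = (if i = m then hcomp s m ^ ?q else 0)"
      using hcomp_homogeneous[OF gr_power[OF hcomp_in_gr], of s i ?q "m * ?q"] q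
      by (auto simp: mult.commute)
  qed simp
  also have "\<dots> = hcomp s m ^ ?q" using fin by (subst sum.delta) auto
  finally show ?thesis .
qed

section \<open>Top local cohomology\<close>

lemma Fract_mult_cancel: "c \<noteq> 0 \<Longrightarrow> Fract (r * c) (s * c) = Fract r s"
  using mult_fract_cancel[of c r s] by (simp add: mult.commute)

lemma sum_Fract:
  assumes "q \<noteq> 0"
  shows "(\<Sum>i\<in>A. Fract (f i) q) = Fract (\<Sum>i\<in>A. f i) q"
proof (induction A rule: infinite_finite_induct)
  case (insert a A)
  have "Fract (f a) q + Fract (\<Sum>i\<in>A. f i) q = Fract ((f a + (\<Sum>i\<in>A. f i)) * q) (q * q)"
    using assms by (simp add: algebra_simps)
  then show ?case using insert assms by (simp add: Fract_mult_cancel)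
qed (simp_all add: fract_collapse)

lemma Fract_power: "Fract r s ^ m = Fract (r ^ m) (s ^ m)"
  by (induction m) (simp_all add: fract_collapse)

text \<open>Elements of the Cech complex are fractions, so the parameters have to be nonzero.\<close>

locale cech_parameters = independent_powers x d
  for x :: "nat \<Rightarrow> 'a::idom" and d +
  assumes x_nonzero: "i < d \<Longrightarrow> x i \<noteq> 0"
begin

lemma prod_x_nonzero: "J \<subseteq> {..<d} \<Longrightarrow> (\<Prod>i\<in>J. x i) \<noteq> 0"
  using x_nonzero finite_subset[of J "{..<d}"] by auto

lemma cech_loc_closed:
  assumes J: "J \<subseteq> {..<d}" and u: "u \<in> cech_loc x J"
  shows cech_loc_minus: "- u \<in> cech_loc x J"
    and cech_loc_scale: "to_fract c * u \<in> cech_loc x J"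
    and cech_loc_power: "u ^ m \<in> cech_loc x J"
    and cech_loc_diff: "v \<in> cech_loc x J \<Longrightarrow> u - v \<in> cech_loc x J"
proof -
  let ?P = "\<Prod>i\<in>J. x i"
  have P: "?P \<noteq> 0" using J by (rule prod_x_nonzero)
  obtain r k where r: "u = Fract r (?P ^ k)" using u by (auto simp: cech_loc_def)
  show "- u \<in> cech_loc x J" unfolding r by (auto simp: cech_loc_def)
  have "to_fract c * u = Fract (c * r) (?P ^ k)" unfolding r by (simp add: to_fract_def)
  then show "to_fract c * u \<in> cech_loc x J" by (auto simp: cech_loc_def)
  have "u ^ m = Fract (r ^ m) (?P ^ (k * m))" unfolding r by (simp add: Fract_power power_mult)
  then show "u ^ m \<in> cech_loc x J" by (auto simp: cech_loc_def)
  show "u - v \<in> cech_loc x J" if v: "v \<in> cech_loc x J"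
  proof -
    obtain s l where s: "v = Fract s (?P ^ l)" using v by (auto simp: cech_loc_def)
    have "u - v = Fract (r * ?P ^ l - s * ?P ^ k) (?P ^ (k + l))"
      unfolding r s using P by (simp add: power_add)
    then show ?thesis by (auto simp: cech_loc_def)
  qed
qed

lemma cech_loc_sign: "J \<subseteq> {..<d} \<Longrightarrow> u \<in> cech_loc x J \<Longrightarrow> (- 1) ^ m * u \<in> cech_loc x J"
  by (induction m) (auto intro: cech_loc_minus)

lemma boundary_subgroup: "additive_subgroup (cech_boundaries x d)"
  unfolding additive_subgroup_def
proof (intro conjI ballI)
  have "0 \<in> cech_loc x J" for J by (auto simp: cech_loc_def fract_collapse intro!: exI[of _ 0])
  then show "0 \<in> cech_boundaries x d"
    unfolding cech_boundaries_def by (auto intro!: exI[of _ "\<lambda>_. 0"])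
next
  fix u v assume "u \<in> cech_boundaries x d" "v \<in> cech_boundaries x d"
  then obtain y y' where y: "\<forall>i<d. y i \<in> cech_loc x ({..<d} - {i})" "u = (\<Sum>i<d. (- 1) ^ i * y i)"
    and y': "\<forall>i<d. y' i \<in> cech_loc x ({..<d} - {i})" "v = (\<Sum>i<d. (- 1) ^ i * y' i)"
    unfolding cech_boundaries_def by blast
  have "u - v = (\<Sum>i<d. (- 1) ^ i * (y i - y' i))"
    unfolding y(2) y'(2) by (simp add: right_diff_distrib sum_subtractf)
  moreover have "\<forall>i<d. y i - y' i \<in> cech_loc x ({..<d} - {i})"
    using y(1) y'(1) by (auto intro!: cech_loc_diff)
  ultimately show "u - v \<in> cech_boundaries x d"
    unfolding cech_boundaries_def by (auto intro!: exI[of _ "\<lambda>i. y i - y' i"])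
qed

lemmas boundary_0 = additive_subgroup_0[OF boundary_subgroup]
  and boundary_add = additive_subgroup_add[OF boundary_subgroup]
  and boundary_minus = additive_subgroup_minus[OF boundary_subgroup]

lemma boundary_sum: "(\<And>i. i \<in> A \<Longrightarrow> f i \<in> cech_boundaries x d) \<Longrightarrow> (\<Sum>i\<in>A. f i) \<in> cech_boundaries x d"
  by (induction A rule: infinite_finite_induct) (auto intro: boundary_0 boundary_add)

lemma boundary_scale:
  assumes "u \<in> cech_boundaries x d"
  shows "to_fract c * u \<in> cech_boundaries x d"
proof -
  obtain y where y: "\<forall>i<d. y i \<in> cech_loc x ({..<d} - {i})" "u = (\<Sum>i<d. (- 1) ^ i * y i)"
    using assms unfolding cech_boundaries_def by blast
  have "to_fract c * u = (\<Sum>i<d. (- 1) ^ i * (to_fract c * y i))"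
    unfolding y(2) by (simp add: sum_distrib_left ac_simps)
  moreover have "\<forall>i<d. to_fract c * y i \<in> cech_loc x ({..<d} - {i})"
    using y(1) by (auto intro!: cech_loc_scale)
  ultimately show ?thesis unfolding cech_boundaries_def by (auto intro!: exI[of _ "\<lambda>i. to_fract c * y i"])
qed

lemma boundary_frobenius:
  assumes "CHAR('a) > 0" "u \<in> cech_boundaries x d"
  shows "u ^ CHAR('a) \<in> cech_boundaries x d"
proof -
  let ?p = "CHAR('a)"
  have p: "prime CHAR('a fract)" using assms(1) prime_CHAR_semidom by (simp add: CHAR_fract)
  obtain y where y: "\<forall>i<d. y i \<in> cech_loc x ({..<d} - {i})" "u = (\<Sum>i<d. (- 1) ^ i * y i)"
    using assms unfolding cech_boundaries_def by blast
  define y' where "y' i = (- 1) ^ (i + i * ?p) * y i ^ ?p" for i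
  have "u ^ ?p = (\<Sum>i<d. ((- 1) ^ i * y i) ^ ?p)"
    unfolding y(2) by (rule freshmans_dream_sum[OF p CHAR_fract[symmetric]])
  also have "\<dots> = (\<Sum>i<d. (- 1) ^ i * y' i)"
    by (intro sum.cong) (simp_all add: y'_def power_mult_distrib power_add power_mult
        flip: mult.assoc power_mult_distrib)
  finally have "u ^ ?p = (\<Sum>i<d. (- 1) ^ i * y' i)" .
  moreover have "\<forall>i<d. y' i \<in> cech_loc x ({..<d} - {i})"
    using y(1) unfolding y'_def by (auto intro!: cech_loc_sign cech_loc_power)
  ultimately show ?thesis unfolding cech_boundaries_def by blast
qed

text \<open>Clearing denominators in a Cech boundary gives \<open>r (x\<^sub>0 \<cdots> x\<^sub>d\<^sub>-\<^sub>1)\<^sup>l \<in> (x\<^sub>0\<^sup>k\<^sup>+\<^sup>l, \<dots>)\<close> for some \<open>l\<close>;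
  the regularity of the parameters removes the factor, so that vanishing of the class is a
  membership in a fixed ideal.\<close>

lemma boundary_iff:
  "Fract r ((\<Prod>i<d. x i) ^ k) \<in> cech_boundaries x d \<longleftrightarrow> r \<in> power_ideal x d (\<lambda>_. k)"
proof
  let ?X = "\<Prod>i<d. x i"
  define P where "P i = (\<Prod>j\<in>{..<d} - {i}. x j)" for i
  have X: "?X \<noteq> 0" by (rule prod_x_nonzero) simp
  have XP: "?X = P i * x i" if "i < d" for i
    using that unfolding P_def by (subst prod.remove[of _ i]) (auto simp: mult.commute)
  have expand: "Fract c (P i ^ l) = Fract (c * x i ^ l) (?X ^ l)" if "i < d" for i c l
    using Fract_mult_cancel[of "x i ^ l" c "P i ^ l"] x_nonzero[OF that]
    by (simp add: XP[OF that] power_mult_distrib)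
  {
    assume "r \<in> power_ideal x d (\<lambda>_. k)"
    then obtain c where c: "r = (\<Sum>i<d. c i * x i ^ k)" by (auto simp: power_ideal_iff)
    define y where "y i = (- 1) ^ i * Fract (c i) (P i ^ k)" for i
    have "Fract r (?X ^ k) = (\<Sum>i<d. Fract (c i * x i ^ k) (?X ^ k))"
      unfolding c using X by (subst sum_Fract) auto
    also have "\<dots> = (\<Sum>i<d. (- 1) ^ i * y i)"
      by (intro sum.cong) (simp_all add: y_def expand flip: mult.assoc power_mult_distrib)
    finally have "Fract r (?X ^ k) = (\<Sum>i<d. (- 1) ^ i * y i)" .
    moreover have "\<forall>i<d. y i \<in> cech_loc x ({..<d} - {i})"
      unfolding y_def by (auto intro!: cech_loc_sign) (auto simp: cech_loc_def P_def)
    ultimately show "Fract r (?X ^ k) \<in> cech_boundaries x d"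
      unfolding cech_boundaries_def by blast
  next
    assume "Fract r (?X ^ k) \<in> cech_boundaries x d"
    then obtain y where y: "\<forall>i<d. y i \<in> cech_loc x ({..<d} - {i})"
      "Fract r (?X ^ k) = (\<Sum>i<d. (- 1) ^ i * y i)"
      unfolding cech_boundaries_def by blast
    from y(1) have "\<forall>i<d. \<exists>c m. y i = Fract c (P i ^ m)" by (auto simp: cech_loc_def P_def)
    then obtain c m where cm: "\<And>i. i < d \<Longrightarrow> y i = Fract (c i) (P i ^ m i)" by metis
    define l where "l = (\<Sum>i<d. m i)"
    define c' where "c' i = (- 1) ^ i * (c i * P i ^ (l - m i))" for i
    have "(- 1) ^ i * y i = Fract (c' i * x i ^ l) (?X ^ l)" if "i < d" for i
    proof -
      have "m i \<le> l" using that unfolding l_def by (intro member_le_sum) auto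
      moreover have "P i \<noteq> 0" unfolding P_def by (rule prod_x_nonzero) auto
      ultimately have "y i = Fract (c i * P i ^ (l - m i)) (P i ^ l)"
        using cm[OF that] Fract_mult_cancel[of "P i ^ (l - m i)" "c i" "P i ^ m i"]
        by (simp flip: power_add)
      moreover have "(- 1) ^ i * Fract a b = Fract ((- 1) ^ i * a) b" for a b :: 'a
        by (cases "even i") auto
      ultimately show ?thesis using expand[OF that] by (simp add: c'_def mult.assoc)
    qed
    then have "Fract r (?X ^ k) = Fract (\<Sum>i<d. c' i * x i ^ l) (?X ^ l)"
      unfolding y(2) using X by (subst sum_Fract[symmetric]) auto
    then have "?X ^ l * r = (\<Sum>i<d. c' i * x i ^ l) * ?X ^ k"
      using X by (simp add: eq_fract mult.commute)
    also have "\<dots> = (\<Sum>i<d. (c' i * P i ^ k) * x i ^ (k + l))"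
      unfolding sum_distrib_right
      by (intro sum.cong) (auto simp: XP power_mult_distrib power_add ac_simps)
    finally have "(\<Prod>i<d. x i ^ l) * r \<in> power_ideal x d (\<lambda>i. if i \<in> {..<d} then k + l else k)"
      unfolding power_ideal_iff prod_power_distrib by (intro exI[of _ "\<lambda>i. c' i * P i ^ k"]) simp
    then show "r \<in> power_ideal x d (\<lambda>_. k)" using cancel_prod[of "{..<d}" l r "\<lambda>_. k"] by simp
  }
qed

lemma lc_class_eq_iff: "lc_class x d u = lc_class x d v \<longleftrightarrow> u - v \<in> cech_boundaries x d"
proof
  assume "lc_class x d u = lc_class x d v"
  moreover have "u + 0 \<in> lc_class x d u"
    unfolding lc_class_def by (rule set_plus_intro2[OF boundary_0])
  ultimately show "u - v \<in> cech_boundaries x d"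
    by (simp add: lc_class_def set_plus_imp_minus)
next
  have sub: "lc_class x d u \<subseteq> lc_class x d v" if "u - v \<in> cech_boundaries x d" for u v
  proof
    fix w assume "w \<in> lc_class x d u"
    then have "w - u \<in> cech_boundaries x d" by (simp add: lc_class_def set_plus_imp_minus)
    then have "(w - u) + (u - v) \<in> cech_boundaries x d" using that by (rule boundary_add)
    then show "w \<in> lc_class x d v" by (simp add: lc_class_def set_minus_imp_plus)
  qed
  assume "u - v \<in> cech_boundaries x d"
  moreover from this have "v - u \<in> cech_boundaries x d" using boundary_minus by fastforce
  ultimately show "lc_class x d u = lc_class x d v" using sub by blast
qed

lemma lc_class_0_iff: "lc_class x d u = lc_class x d 0 \<longleftrightarrow> u \<in> cech_boundaries x d"
  using lc_class_eq_iff[of u 0] by simp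

text \<open>Reduces the definition of a map on cosets by means of all representatives to a single
  representative.\<close>

lemma class_Union:
  assumes "\<And>v. v - u \<in> cech_boundaries x d \<Longrightarrow> f v - f u \<in> cech_boundaries x d"
  shows "(\<Union>v\<in>lc_class x d u. lc_class x d (f v)) = lc_class x d (f u)"
proof -
  have mem: "v \<in> lc_class x d u \<longleftrightarrow> v - u \<in> cech_boundaries x d" for v
    by (simp add: lc_class_def set_minus_plus)
  have "lc_class x d (f v) = lc_class x d (f u)" if "v \<in> lc_class x d u" for v
    using that assms by (simp add: mem lc_class_eq_iff)
  moreover have "u \<in> lc_class x d u" by (simp add: mem boundary_0)
  ultimately show ?thesis by blast
qed

lemma lc_scale_class: "lc_scale x d c (lc_class x d u) = lc_class x d (to_fract c * u)"
  unfolding lc_scale_def by (rule class_Union) (simp add: boundary_scale flip: right_diff_distrib)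

context
  assumes char: "CHAR('a) > 0"
begin

lemma lc_frobenius_class: "lc_frobenius x d (lc_class x d u) = lc_class x d (u ^ CHAR('a))"
  unfolding lc_frobenius_def
proof (rule class_Union)
  fix v assume "v - u \<in> cech_boundaries x d"
  then have "(v - u) ^ CHAR('a) \<in> cech_boundaries x d" by (rule boundary_frobenius[OF char])
  moreover have p: "prime CHAR('a fract)" using char prime_CHAR_semidom by (simp add: CHAR_fract)
  have "((v - u) + u) ^ CHAR('a) = (v - u) ^ CHAR('a) + u ^ CHAR('a)"
    by (rule freshmans_dream[OF p CHAR_fract[symmetric]])
  ultimately show "v ^ CHAR('a) - u ^ CHAR('a) \<in> cech_boundaries x d" by simp
qed

lemma lc_frobenius_funpow_class:
  "(lc_frobenius x d ^^ e) (lc_class x d u) = lc_class x d (u ^ (CHAR('a) ^ e))"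
  by (induction e) (simp_all add: lc_frobenius_class flip: power_mult, simp add: mult.commute)

end

end

section \<open>Tight closure of zero\<close>

locale graded_cech = graded_ring gr + cech_parameters x d
  for gr :: "nat \<Rightarrow> 'a::idom set" and x d +
  fixes deg :: "nat \<Rightarrow> nat"
  assumes deg_x: "i < d \<Longrightarrow> x i \<in> gr (deg i)" "i < d \<Longrightarrow> 0 < deg i"
    and char: "CHAR('a) > 0"
begin

lemma hcomp_power_ideal: "s \<in> power_ideal x d a \<Longrightarrow> hcomp s i \<in> power_ideal x d a"
  unfolding power_ideal_def by (rule ideal_gen_homogeneous) (auto intro: gr_power deg_x)

lemma lc_class_component:
  assumes "u \<in> cech_component gr x deg d j" "j \<in> T"
  shows "lc_class x d u \<in> lc_part gr x deg d T"
  unfolding lc_part_def using assms by (auto intro!: exI[of _ "{j}"] exI[of _ "\<lambda>_. u"])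

lemma cech_component_Fract:
  assumes "r \<in> gr m"
  shows "Fract r ((\<Prod>i<d. x i) ^ k) \<in> cech_component gr x deg d (int m - int (k * (\<Sum>i<d. deg i)))"
  unfolding cech_component_def using assms by (auto simp: Let_def intro!: exI[of _ r] exI[of _ k])

text \<open>The Frobenius images of the class of \<open>r / (x\<^sub>0 \<cdots> x\<^sub>d\<^sub>-\<^sub>1)\<^sup>k\<close> stay in degrees at most \<open>b\<close>, as
  multiplying a nonpositive degree by the characteristic does not raise it. So injectivity of the
  Frobenius action can be used at every step of the iteration.\<close>

lemma frobenius_injective_power:
  assumes inj: "inj_on (lc_frobenius x d) (lc_part gr x deg d {..b})" and "b \<le> 0"
    and r: "r \<in> gr m" and deg_le: "int m - int (k * (\<Sum>i<d. deg i)) \<le> b"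
    and zero: "r ^ (CHAR('a) ^ e) \<in> power_ideal x d (\<lambda>_. k * CHAR('a) ^ e)"
  shows "r \<in> power_ideal x d (\<lambda>_. k)"
proof -
  let ?X = "\<Prod>i<d. x i" and ?\<sigma> = "\<Sum>i<d. deg i"
  define u where "u = Fract r (?X ^ k)"
  have power: "u ^ (CHAR('a) ^ e) = Fract (r ^ (CHAR('a) ^ e)) (?X ^ (k * CHAR('a) ^ e))" for e
    by (simp add: u_def Fract_power power_mult)
  have part: "lc_class x d (u ^ (CHAR('a) ^ e)) \<in> lc_part gr x deg d {..b}" for e
  proof (rule lc_class_component)
    let ?q = "CHAR('a) ^ e"
    show "u ^ ?q \<in> cech_component gr x deg d (int (?q * m) - int (k * ?q * ?\<sigma>))"
      unfolding power by (intro cech_component_Fract gr_power r)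
    have "int (?q * m) - int (k * ?q * ?\<sigma>) = int ?q * (int m - int (k * ?\<sigma>))"
      by (simp add: algebra_simps)
    also have "\<dots> \<le> 1 * (int m - int (k * ?\<sigma>))"
      using char deg_le \<open>b \<le> 0\<close> by (intro mult_right_mono_neg) (auto simp: Suc_leI simp flip: of_nat_power)
    finally show "int (?q * m) - int (k * ?q * ?\<sigma>) \<in> {..b}" using deg_le by simp
  qed
  have zero_part: "lc_class x d 0 \<in> lc_part gr x deg d {..b}"
    unfolding lc_part_def by (auto intro!: exI[of _ "{}"])
  have "lc_class x d (u ^ (CHAR('a) ^ e)) = lc_class x d 0"
    using zero unfolding power lc_class_0_iff boundary_iff .
  then have "lc_class x d u = lc_class x d 0"
  proof (induction e)
    case (Suc e)
    have "lc_frobenius x d (lc_class x d (u ^ (CHAR('a) ^ e))) = lc_frobenius x d (lc_class x d 0)"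
      using Suc.prems char by (simp add: lc_frobenius_class zero_power mult.commute flip: power_mult)
    then have "lc_class x d (u ^ (CHAR('a) ^ e)) = lc_class x d 0"
      by (rule inj_onD[OF inj _ part zero_part])
    then show ?case by (rule Suc.IH)
  qed simp
  then show ?thesis by (simp add: lc_class_0_iff u_def boundary_iff)
qed

lemma tight_closure_of_lc:
  assumes "Fract r ((\<Prod>i<d. x i) ^ k) = u"
    and "lc_class x d u \<in> lc_tight_closure_zero x d"
  shows "r \<in> tight_closure (power_ideal x d (\<lambda>_. k))"
proof -
  obtain c where c: "c \<noteq> 0"
    and zero: "\<And>e. lc_scale x d c ((lc_frobenius x d ^^ e) (lc_class x d u)) = lc_class x d 0"
    using assms(2) by (auto simp: lc_tight_closure_zero_def)
  have "c * r ^ (CHAR('a) ^ e) \<in> frobenius_power (power_ideal x d (\<lambda>_. k)) (CHAR('a) ^ e)" for e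
  proof -
    have "to_fract c * u ^ (CHAR('a) ^ e)
        = Fract (c * r ^ (CHAR('a) ^ e)) ((\<Prod>i<d. x i) ^ (k * CHAR('a) ^ e))"
      by (simp add: Fract_power power_mult to_fract_def flip: assms(1))
    then show ?thesis
      using zero[of e]
      by (simp add: lc_frobenius_funpow_class[OF char] lc_scale_class lc_class_0_iff boundary_iff
          frobenius_power_power_ideal[OF char])
  qed
  then show ?thesis using c unfolding tight_closure_def by auto
qed

text \<open>The exponent is uniform in the class and in \<open>e\<close>: a test element multiplies all Frobenius
  powers of elements of a tight closure into the corresponding Frobenius powers of the ideal.\<close>

lemma parameter_power_kills:
  assumes test: "\<And>i. i < d \<Longrightarrow> \<exists>N. test_element (x i ^ N)"
  obtains N where "\<And>k r e i. r \<in> tight_closure (power_ideal x d (\<lambda>_. k)) \<Longrightarrow> i < d \<Longrightarrow>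
    x i ^ N * r ^ (CHAR('a) ^ e) \<in> power_ideal x d (\<lambda>_. k * CHAR('a) ^ e)"
proof -
  from test obtain M where M: "\<And>i. i < d \<Longrightarrow> test_element (x i ^ M i)" by metis
  have "x i ^ (\<Sum>i<d. M i) * r ^ (CHAR('a) ^ e) \<in> power_ideal x d (\<lambda>_. k * CHAR('a) ^ e)"
    if r: "r \<in> tight_closure (power_ideal x d (\<lambda>_. k))" and i: "i < d" for k r e i
  proof -
    have "x i ^ M i * r ^ (CHAR('a) ^ e) \<in> power_ideal x d (\<lambda>_. k * CHAR('a) ^ e)"
      using M[OF i] r unfolding test_element_def frobenius_power_power_ideal[OF char, symmetric]
      using ideal_power_ideal by blast
    then have "x i ^ ((\<Sum>i<d. M i) - M i) * (x i ^ M i * r ^ (CHAR('a) ^ e))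
        \<in> power_ideal x d (\<lambda>_. k * CHAR('a) ^ e)"
      by (rule ideal_mult[OF ideal_power_ideal])
    moreover have "M i \<le> (\<Sum>i<d. M i)" using i by (intro member_le_sum) auto
    ultimately show ?thesis by (simp flip: mult.assoc power_add)
  qed
  then show thesis by (rule that)
qed

text \<open>By the colon formula \<open>s\<close> is congruent to a multiple of the product of the \<open>x\<^sub>i\<^sup>l\<^sup>-\<^sup>N\<close>, whose
  degree exceeds that of \<open>s\<close>; in degree \<open>m\<close> only the ideal remains.\<close>

lemma low_degree_in_power_ideal:
  assumes N: "N \<le> l" and m: "m < (l - N) * (\<Sum>i<d. deg i)" and s: "s \<in> gr m"
    and kills: "\<And>i. i < d \<Longrightarrow> x i ^ N * s \<in> power_ideal x d (\<lambda>_. l)"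
  shows "s \<in> power_ideal x d (\<lambda>_. l)"
proof -
  let ?Y = "\<Prod>i<d. x i ^ (l - N)"
  obtain t where t: "s - t * ?Y \<in> power_ideal x d (\<lambda>_. l)"
    using colon_power_ideal[OF N kills] by blast
  have "?Y \<in> gr (\<Sum>i<d. (l - N) * deg i)" by (intro gr_prod gr_power deg_x) auto
  then have Y: "?Y \<in> gr ((l - N) * (\<Sum>i<d. deg i))" by (simp add: sum_distrib_left)
  have "hcomp (s - t * ?Y) m = s"
    using m by (simp add: hcomp_diff hcomp_homogeneous[OF s] mult.commute[of t] hcomp_mult_homogeneous[OF Y])
  then show ?thesis using hcomp_power_ideal[OF t, of m] by simp
qed

text \<open>The class of \<open>hcomp r m\<close> over \<open>(x\<^sub>0 \<cdots> x\<^sub>d\<^sub>-\<^sub>1)\<^sup>k\<close> has negative degree, so its Frobenius powers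
  have arbitrarily negative degrees, while being annihilated by all \<open>x\<^sub>i\<^sup>N\<close> keeps nonzero classes in
  degrees at least \<open>- N * (\<Sum>i<d. deg i)\<close>.\<close>

lemma tight_closure_low_degree:
  assumes kills: "\<And>e i. i < d \<Longrightarrow>
      x i ^ N * r ^ (CHAR('a) ^ e) \<in> power_ideal x d (\<lambda>_. k * CHAR('a) ^ e)"
    and m: "m < k * (\<Sum>i<d. deg i)"
  shows "\<exists>e. hcomp r m ^ (CHAR('a) ^ e) \<in> power_ideal x d (\<lambda>_. k * CHAR('a) ^ e)"
proof -
  let ?\<sigma> = "\<Sum>i<d. deg i"
  (* Any exponent e with p^e > N * \<sigma> will do, where -N * \<sigma> bounds the degrees from below. *)
  define e where "e = N * ?\<sigma>"
  define q where "q = CHAR('a) ^ e"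
  have "CHAR('a) > 1" using prime_CHAR_semidom[OF char] prime_gt_1_nat by blast
  then have q: "N * ?\<sigma> < q" unfolding q_def e_def by (simp add: power_gt_expt)
  have pos: "0 < k" "0 < ?\<sigma>" using m by (auto intro: ccontr)
  have "N * 1 \<le> N * ?\<sigma>" using pos by (intro mult_left_mono) auto
  moreover have "1 * q \<le> k * q" using pos by (intro mult_right_mono) auto
  ultimately have N: "N \<le> k * q" using q by linarith
  have "(m + 1) * q \<le> (k * ?\<sigma>) * q" using m by (intro mult_right_mono) auto
  then have "m * q + N * ?\<sigma> < k * q * ?\<sigma>" using q by (simp add: algebra_simps)
  then have "q * m < (k * q - N) * ?\<sigma>"
    unfolding diff_mult_distrib mult.commute[of q m] by linarith
  moreover have "hcomp r m ^ q \<in> gr (q * m)" by (intro gr_power hcomp_in_gr)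
  moreover have "x i ^ N * hcomp r m ^ q \<in> power_ideal x d (\<lambda>_. k * q)" if i: "i < d" for i
  proof -
    have "hcomp (x i ^ N * r ^ q) (N * deg i + m * q) = x i ^ N * hcomp (r ^ q) (m * q)"
      by (simp add: hcomp_mult_homogeneous[OF gr_power[OF deg_x(1)[OF i]]])
    also have "hcomp (r ^ q) (m * q) = hcomp r m ^ q"
      unfolding q_def by (rule hcomp_frobenius[OF graded_ring_axioms char])
    finally show ?thesis
      using hcomp_power_ideal[OF kills[OF i, of e], of "N * deg i + m * q"] by (simp add: q_def)
  qed
  ultimately have "hcomp r m ^ q \<in> power_ideal x d (\<lambda>_. k * q)"
    using low_degree_in_power_ideal[OF N] by blast
  then show ?thesis unfolding q_def by blast
qed

theorem lc_tight_closure_zero_subset: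
  assumes test: "\<And>i. i < d \<Longrightarrow> \<exists>N. test_element (x i ^ N)"
    and inj: "inj_on (lc_frobenius x d) (lc_part gr x deg d {..b})" and b: "b < 0"
  shows "lc_tight_closure_zero x d \<subseteq> lc_part gr x deg d {b<..}"
proof
  let ?X = "\<Prod>i<d. x i" and ?\<sigma> = "\<Sum>i<d. deg i"
  fix \<eta> assume \<eta>: "\<eta> \<in> lc_tight_closure_zero x d"
  then obtain r k where rk: "\<eta> = lc_class x d (Fract r (?X ^ k))"
    by (auto simp: lc_tight_closure_zero_def local_cohomology_def cech_loc_def)
  have X: "?X ^ k \<noteq> 0" using prod_x_nonzero[of "{..<d}"] by simp
  obtain N where N: "\<And>k r e i. r \<in> tight_closure (power_ideal x d (\<lambda>_. k)) \<Longrightarrow> i < d \<Longrightarrow>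
    x i ^ N * r ^ (CHAR('a) ^ e) \<in> power_ideal x d (\<lambda>_. k * CHAR('a) ^ e)"
    using parameter_power_kills test by blast
  have r: "r \<in> tight_closure (power_ideal x d (\<lambda>_. k))"
    using tight_closure_of_lc[OF refl] \<eta> rk by simp
  have low: "hcomp r m \<in> power_ideal x d (\<lambda>_. k)" if m: "int m - int (k * ?\<sigma>) \<le> b" for m
  proof -
    have "m < k * ?\<sigma>" using m b by linarith
    then obtain e where "hcomp r m ^ (CHAR('a) ^ e) \<in> power_ideal x d (\<lambda>_. k * CHAR('a) ^ e)"
      using tight_closure_low_degree[OF N[OF r]] by blast
    then show ?thesis using frobenius_injective_power[OF inj _ hcomp_in_gr m] b by simp
  qed
  (* The components of degree at most b are boundaries, so the others represent the class. *)
  let ?u = "\<lambda>m. Fract (hcomp r m) (?X ^ k)"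
  define L where "L = {m. hcomp r m \<noteq> 0 \<and> int m - int (k * ?\<sigma>) \<le> b}"
  define H where "H = {m. hcomp r m \<noteq> 0 \<and> b < int m - int (k * ?\<sigma>)}"
  have fin: "finite L" "finite H"
    by (auto simp: L_def H_def intro: finite_subset[OF _ finite_hcomp[of r]])
  have LH: "{m. hcomp r m \<noteq> 0} = L \<union> H" "L \<inter> H = {}" by (auto simp: L_def H_def)
  have "Fract r (?X ^ k) = (\<Sum>m\<in>L \<union> H. ?u m)"
    by (subst sum_Fract[OF X], subst LH(1)[symmetric], subst sum_hcomp[symmetric]) simp
  also have "\<dots> = (\<Sum>m\<in>L. ?u m) + (\<Sum>m\<in>H. ?u m)" using fin LH(2) by (rule sum.union_disjoint)
  finally have "Fract r (?X ^ k) - (\<Sum>m\<in>H. ?u m) = (\<Sum>m\<in>L. ?u m)" by simp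
  moreover have "(\<Sum>m\<in>L. ?u m) \<in> cech_boundaries x d"
    by (intro boundary_sum) (simp add: boundary_iff low L_def)
  ultimately have "\<eta> = lc_class x d (\<Sum>m\<in>H. ?u m)"
    unfolding rk lc_class_eq_iff by simp
  also have "(\<Sum>m\<in>H. ?u m) = (\<Sum>j\<in>(\<lambda>m. int m - int (k * ?\<sigma>)) ` H. ?u (nat (j + int (k * ?\<sigma>))))"
    by (subst sum.reindex) (auto simp: inj_on_def)
  also have "lc_class x d \<dots> \<in> lc_part gr x deg d {b<..}"
    unfolding lc_part_def
  proof (intro CollectI exI conjI ballI)
    show "finite ((\<lambda>m. int m - int (k * ?\<sigma>)) ` H)" using fin by simp
    show "(\<lambda>m. int m - int (k * ?\<sigma>)) ` H \<subseteq> {b<..}" by (auto simp: H_def)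
    fix j assume "j \<in> (\<lambda>m. int m - int (k * ?\<sigma>)) ` H"
    then obtain m where "j = int m - int (k * ?\<sigma>)" by auto
    then show "?u (nat (j + int (k * ?\<sigma>))) \<in> cech_component gr x deg d j"
      using cech_component_Fract[OF hcomp_in_gr, of r m k] by simp
  qed (rule refl)
  finally show "\<eta> \<in> lc_part gr x deg d {b<..}" .
qed

end

theorem theorem2p1:
  fixes gr :: "nat \<Rightarrow> 'a::idom set"
    and x :: "nat \<Rightarrow> 'a" and deg :: "nat \<Rightarrow> nat" and d n :: nat
  assumes "nat_grading gr"
    and "cohen_macaulay TYPE('a)"
    and "normal_domain TYPE('a)"
    and "is_subfield (gr 0)"
    and "CHAR('a) > 0"
    and "finitely_generated_algebra (gr 0)"
    and "krull_dim TYPE('a) = enat d"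
    and "homogeneous_sop gr d x deg"
    and "\<forall>a\<in>irrelevant_ideal gr. a \<noteq> 0 \<longrightarrow> (\<exists>N>0. test_element (a ^ N))"
    and "n > 0"
    and "inj_on (lc_frobenius x d) (lc_part gr x deg d {.. - int n})"
  shows "lc_tight_closure_zero x d \<subseteq> lc_part gr x deg d {- int n <..}"
proof -
  interpret graded_ring gr by unfold_locales fact
  have deg: "0 < deg i" "x i \<in> gr (deg i)" if "i < d" for i
    using assms(8) that by (auto simp: homogeneous_sop_def)
  have rad: "{s. \<exists>m. s ^ m \<in> ideal_gen (x ` {..<d})} = irrelevant_ideal gr"
    using assms(8) by (simp add: homogeneous_sop_def)
  have x_irrelevant: "x i \<in> irrelevant_ideal gr" if "i < d" for i
    unfolding irrelevant_ideal_def using deg[OF that] by (intro ideal_gen_base) auto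
  obtain ys where ys: "regular_sequence ys" "length ys = d" "set ys \<subseteq> irrelevant_ideal gr"
    using regular_sequence_in_irrelevant[OF assms(4,2,7)] by blast
  interpret independent_powers x d
    by (rule independent_powers_of_regular_sequence[OF ys(1,2)]) (use ys(3) rad in blast)
  have x_nonzero: "x i \<noteq> 0" if i: "i < d" for i
  proof
    assume "x i = 0"
    then have "1 \<in> ideal_gen ((\<lambda>j. x j ^ 1) ` ({..<d} - {i}))"
      using cancel_generator[OF i, of 1 "\<lambda>_. 1"] by (simp add: regular_module.span_zero)
    also have "\<dots> \<subseteq> irrelevant_ideal gr"
      using x_irrelevant by (intro ideal_gen_minimal ideal_irrelevant) auto
    finally show False using prime_ideal_1[OF prime_irrelevant[OF assms(4)]] by simp
  qed
  interpret graded_cech gr x d deg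
    by unfold_locales (use x_nonzero deg assms(5) in auto)
  show ?thesis
  proof (rule lc_tight_closure_zero_subset)
    show "\<exists>N. test_element (x i ^ N)" if "i < d" for i
      using assms(9) x_irrelevant[OF that] x_nonzero[OF that] by blast
  qed (use assms(10,11) in auto)
qed

end
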